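(* Suppose that a locally Lipschitz function $f:\mathbb{R}^d\to\mathbb{R}$ satisfies the $(\alpha,\beta)$ subgradient growth condition, let $\delta>0$, and let $f_\delta(\mathbf{x})=\mathbb{E}_{\mathbf{w}}[f(\mathbf{x}+\delta\mathbf{w})]$ with $\mathbf{w}$ uniform on the closed unit ball of $\mathbb{R}^d$. Then $f_\delta$ is continuously differentiable and $\nabla f_\delta(\mathbf{x})=\mathbb{E}_{\mathbf{w}}[\nabla f(\mathbf{x}+\delta\mathbf{w})]$ for every $\mathbf{x}\in\mathbb{R}^d$. Furthermore, $\nabla f_\delta(\mathbf{x})\in\partial_\delta f(\mathbf{x})$ for every $\mathbf{x}\in\mathbb{R}^d$.
   Context: $\partial f$ is the Clarke subdifferential, and the Goldstein $\delta$-subdifferential is $\partial_\delta f(\mathbf{x})=\mathrm{conv}\big(\bigcup_{\|\mathbf{y}-\mathbf{x}\|\le\delta}\partial f(\mathbf{y})\big)$, with $\|\cdot\|$ the Euclidean norm. A locally Lipschitz $f$ is differentiable almost everywhere, so $\nabla f(\mathbf{x}+\delta\mathbf{w})$ is defined for almost every $\mathbf{w}$. Subgradient growth condition: let $\alpha:\mathbb{R}^d\to\mathbb{R}_+$ and $\beta:\mathbb{R}^d\times\mathbb{R}_+\to\mathbb{R}_+$ be continuous, with $\beta(\mathbf{x},r)$ non-decreasing in $r$. The function $f$ satisfies the $(\alpha,\beta)$ subgradient growth condition if $\sup_{\zeta\in\partial f(\mathbf{x})}\|\zeta\|\le\alpha(\mathbf{x})$ for all $\mathbf{x}$, and $|\alpha(\mathbf{x})-\alpha(\mathbf{y})|\le\beta(\mathbf{x},\|\mathbf{y}-\mathbf{x}\|)$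 for all $\mathbf{x},\mathbf{y}\in\mathbb{R}^d$. *)

theory Defs
  imports "HOL-Analysis.Analysis"
begin

definition locally_lipschitz :: "('a::metric_space \<Rightarrow> 'b::metric_space) \<Rightarrow> bool" where
  "locally_lipschitz f \<longleftrightarrow> (\<forall>x. \<exists>r>0. \<exists>L. L-lipschitz_on (cball x r) f)"

(* The gradient has an unspecified value at points where f is not differentiable. *)
definition grad :: "('a::real_inner \<Rightarrow> real) \<Rightarrow> 'a \<Rightarrow> 'a" where
  "grad f x = (THE D. GDERIV f x :> D)"

(* Clarke's generalized directional derivative: the limsup of (f (y + t v) - f y) / t as
   y tends to x (y = x allowed) and t decreases to 0, as an extended real. *)
definition clarke_dderiv :: "('a::real_normed_vector \<Rightarrow> real) \<Rightarrow> 'a \<Rightarrow> 'a \<Rightarrow> ereal" where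
  "clarke_dderiv f x v =
     Limsup (nhds x \<times>\<^sub>F at_right (0::real)) (\<lambda>(y, t). ereal ((f (y + t *\<^sub>R v) - f y) / t))"

definition clarke_subdiff :: "('a::real_inner \<Rightarrow> real) \<Rightarrow> 'a \<Rightarrow> 'a set" where
  "clarke_subdiff f x = {\<zeta>. \<forall>v. ereal (\<zeta> \<bullet> v) \<le> clarke_dderiv f x v}"

definition goldstein_subdiff :: "real \<Rightarrow> ('a::real_inner \<Rightarrow> real) \<Rightarrow> 'a \<Rightarrow> 'a set" where
  "goldstein_subdiff \<delta> f x = convex hull (\<Union>y\<in>cball x \<delta>. clarke_subdiff f y)"

(* Since \<beta> has domain 'a \<times> [0, \<infinity>), all conditions on it are restricted to r \<ge> 0. *)
definition subgradient_growth ::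
  "('a::real_inner \<Rightarrow> real) \<Rightarrow> ('a \<Rightarrow> real \<Rightarrow> real) \<Rightarrow> ('a \<Rightarrow> real) \<Rightarrow> bool" where
  "subgradient_growth \<alpha> \<beta> f \<longleftrightarrow>
     continuous_on UNIV \<alpha> \<and> (\<forall>x. 0 \<le> \<alpha> x) \<and>
     continuous_on (UNIV \<times> {0..}) (\<lambda>(x, r). \<beta> x r) \<and> (\<forall>x. \<forall>r\<ge>0. 0 \<le> \<beta> x r) \<and>
     (\<forall>x. mono_on {0..} (\<beta> x)) \<and>
     (\<forall>x. (SUP \<zeta>\<in>clarke_subdiff f x. ereal (norm \<zeta>)) \<le> ereal (\<alpha> x)) \<and>
     (\<forall>x y. \<bar>\<alpha> x - \<alpha> y\<bar> \<le> \<beta> x (norm (y - x)))"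

definition unif_ball :: "'a::euclidean_space measure" where
  "unif_ball = uniform_measure lborel (cball 0 1)"

definition ball_smoothing :: "real \<Rightarrow> ('a::euclidean_space \<Rightarrow> real) \<Rightarrow> 'a \<Rightarrow> real" where
  "ball_smoothing \<delta> f x = (LINT w|unif_ball. f (x + \<delta> *\<^sub>R w))"

end

theory Submission
  imports Defs "HOL-Probability.Probability_Measure"
begin

text \<open>
  Differentiation under the expectation is dominated convergence once \<open>f\<close> is known to be
  differentiable almost everywhere, so the substance of the proof is Rademacher's theorem.

  Rademacher's theorem starts on the line. A Lipschitz function plus a steep linear function is a
  bi-Lipschitz bijection \<open>F\<close>; the measure \<open>A \<mapsto> |F(A)|\<close> is absolutely continuous, hence has a
  Radon--Nikodym density, and so a Lipschitz function is an indefinite integral. The Lebesgue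
  differentiation theorem gives its derivative (\<open>lipschitz_real_differentiable_AE\<close>). In \<open>d\<close>
  dimensions, Tonelli along the lines \<open>t \<mapsto> x + t v\<close> turns this into the existence of each directional
  derivative \<open>D\<^sub>v f\<close> almost everywhere (\<open>lipschitz_dir_limit_AE\<close>). For additivity in \<open>v\<close>, split the
  quotient in direction \<open>u + v\<close> at the intermediate point \<open>x + t u\<close>, integrate over a cube, and let
  \<open>t\<close> tend to 0: the cube integrals of \<open>D\<^bsub>u+v\<^esub> f\<close> and \<open>D\<^sub>u f + D\<^sub>v f\<close> agree, so the functions
  agree almost everywhere (\<open>lipschitz_dir_deriv_add_AE\<close>). Outside one null set the directional
  derivatives are therefore linear on a countable dense set of directions, and the Lipschitz bound
  together with compactness of the sphere upgrades this to Frechet differentiability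
  (\<open>lipschitz_differentiable_if_linear_on_dense\<close>). Composing with the projection onto large balls
  extends the result to locally Lipschitz functions.

  For the smoothing, the local Lipschitz constant dominates both the difference quotients and the
  gradient, which gives \<open>\<nabla>f\<^sub>\<delta>(x) = \<E> \<nabla>f(x + \<delta>w)\<close> (\<open>GDERIV_ball_smoothing\<close>). The right side is
  continuous in \<open>x\<close> because it is an integral of a locally bounded function over a moving ball whose
  boundary is null. Finally, gradients are Clarke subgradients, so the expectation is a mean of
  points of the union of the subdifferentials \<open>\<partial>f(y)\<close> over the closed ball; that union is compact by
  upper semicontinuity, hence so is its convex hull, and a closed convex set contains the mean of
  every random vector with values in it.
\<close>

section \<open>Lipschitz functions on the line\<close>

text \<open>
  A Lipschitz function is absolutely continuous. Instead of working with that notion, add a linear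
  function so that \<open>F\<close> becomes a bijection with Lipschitz inverse \<open>G\<close>; the image of Lebesgue measure
  under \<open>G\<close> assigns mass \<open>F b - F a\<close> to \<open>[a, b]\<close> and vanishes on null sets because \<open>F\<close> is Lipschitz.
\<close>

lemma lipschitz_real_has_density:
  fixes f :: "real \<Rightarrow> real"
  assumes lip: "L-lipschitz_on UNIV f"
  obtains g :: "real \<Rightarrow> real" where "\<And>a b. a \<le> b \<Longrightarrow> (g has_integral (f b - f a)) {a..b}"
proof -
  \<comment> \<open>Slope \<open>L\<close> would make \<open>F\<close> nondecreasing; the extra 1 gives an inverse with Lipschitz constant 1.\<close>
  define F where "F = (\<lambda>x. f x + (L + 1) * x)"
  have fab: "\<bar>f b - f a\<bar> \<le> L * (b - a)" if "a \<le> b" for a b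
    using lipschitz_onD[OF lip, of b a] that by (auto simp: dist_real_def)
  have L0: "0 \<le> L"
    using lip by (rule lipschitz_on_nonneg)
  have grow: "b - a \<le> F b - F a" if "a \<le> b" for a b
    using fab[OF that] by (simp add: F_def algebra_simps abs_le_iff)
  have Fup: "F b - F a \<le> (2 * L + 1) * (b - a)" if "a \<le> b" for a b
    using fab[OF that] by (simp add: F_def algebra_simps abs_le_iff)
  have contF: "continuous_on UNIV F"
    unfolding F_def using lipschitz_on_continuous_on[OF lip] by (intro continuous_intros)
  have mono: "F a \<le> F b \<longleftrightarrow> a \<le> b" for a b
    using grow[of a b] grow[of b a] by (cases "a \<le> b") auto
  have "inj F"
    by (rule injI) (metis mono order.antisym order.refl)
  have "surj F"
    unfolding surj_def
  proof
    fix y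
    define m where "m = \<bar>y - F 0\<bar>"
    have m: "0 \<le> m" "F 0 - m \<le> y" "y \<le> F 0 + m"
      by (auto simp: m_def)
    then have "F (- m) \<le> y" "y \<le> F m"
      using grow[of "- m" 0] grow[of 0 m] by auto
    moreover have "continuous_on {- m..m} F"
      using contF by (rule continuous_on_subset) simp
    ultimately obtain x where "F x = y"
      using IVT'[of F "- m" y m] \<open>0 \<le> m\<close> by auto
    then show "\<exists>x. y = F x"
      by blast
  qed
  define G where "G = inv F"
  have GF [simp]: "G (F x) = x" for x
    unfolding G_def using \<open>inj F\<close> by simp
  have FG [simp]: "F (G y) = y" for y
    unfolding G_def using \<open>surj F\<close> by (simp add: surj_f_inv_f)
  have "mono G"
    by (rule monoI) (metis FG mono)
  then have [measurable]: "G \<in> borel_measurable borel"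
    by (rule borel_measurable_mono)
  have vimage: "G -` A = F ` A" for A
    by (auto simp: image_iff) (metis FG)
  define \<mu> where "\<mu> = distr lborel lborel G"
  have em: "emeasure \<mu> A = emeasure lborel (F ` A)" if "A \<in> sets borel" for A
    using that by (simp add: \<mu>_def emeasure_distr vimage)
  have ac: "absolutely_continuous lborel \<mu>"
    unfolding absolutely_continuous_def
  proof
    fix N :: "real set" assume N: "N \<in> null_sets lborel"
    then have neg: "negligible N"
      by (simp add: negligible_iff_null_sets null_sets_completionI)
    have "negligible (F ` N)"
    proof (rule negligible_locally_Lipschitz_image[OF _ neg])
      fix x assume "x \<in> N"
      have "norm (F y - F x) \<le> (2 * L + 1) * norm (y - x)" for y
        using Fup[of x y] Fup[of y x] grow[of x y] grow[of y x] by (cases "x \<le> y") auto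
      then show "\<exists>T B. open T \<and> x \<in> T \<and> (\<forall>y\<in>N \<inter> T. norm (F y - F x) \<le> B * norm (y - x))"
        by (intro exI[of _ UNIV] exI[of _ "2 * L + 1"]) auto
    qed simp
    moreover have "F ` N \<in> sets borel"
      using measurable_sets_borel[of G borel N] N by (simp add: vimage null_sets_def)
    ultimately have "emeasure lborel (F ` N) = 0"
      by (simp add: negligible_iff_null_sets null_sets_completion_iff null_setsD1)
    then show "N \<in> null_sets \<mu>"
      using N em[of N] by (auto simp: null_sets_def \<mu>_def)
  qed
  have "sets \<mu> = sets lborel" by (simp add: \<mu>_def)
  from sigma_finite_measure.Radon_Nikodym[OF sigma_finite_lborel ac this]
  obtain k where k [measurable]: "k \<in> borel_measurable borel" and dens: "density lborel k = \<mu>"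
    by auto
  have int: "(\<integral>\<^sup>+x. k x * indicator {a..b} x \<partial>lborel) = ennreal (F b - F a)" if "a \<le> b" for a b
  proof -
    have "F ` {a..b} = {F a..F b}"
      unfolding vimage[symmetric] set_eq_iff vimage_eq atLeastAtMost_iff by (metis FG mono)
    then have "emeasure \<mu> {a..b} = ennreal (F b - F a)"
      using em[of "{a..b}"] that mono by simp
    then show ?thesis
      by (simp add: dens[symmetric] emeasure_density)
  qed
  \<comment> \<open>The density is a priori extended-valued; its integrals over bounded intervals are finite.\<close>
  have "AE x in lborel. \<forall>n::nat. k x * indicator {- real n..real n} x \<noteq> \<infinity>"
    unfolding AE_all_countable
    by (intro allI nn_integral_PInf_AE) (auto simp: int)
  then have fin: "AE x in lborel. k x \<noteq> \<infinity>"
  proof eventually_elim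
    case (elim x)
    obtain n where "\<bar>x\<bar> \<le> real n" using real_arch_simple by blast
    then show ?case using elim[rule_format, of n] by (auto simp: indicator_def abs_le_iff)
  qed
  show thesis
  proof
    fix a b :: real assume "a \<le> b"
    have "(\<integral>\<^sup>+x. ennreal (enn2real (k x) * indicator {a..b} x) \<partial>lborel) = ennreal (F b - F a)"
      unfolding int[OF \<open>a \<le> b\<close>, symmetric]
    proof (rule nn_integral_cong_AE, use fin in eventually_elim)
      case (elim x)
      then show ?case by (cases "k x") (auto simp: indicator_def)
    qed
    then have "((\<lambda>x. enn2real (k x) * indicator {a..b} x) has_integral (F b - F a)) UNIV"
      by (intro nn_integral_has_integral) (use mono \<open>a \<le> b\<close> in auto)
    moreover have "(\<lambda>x. enn2real (k x) * indicator {a..b} x) = (\<lambda>x. if x \<in> {a..b} then enn2real (k x) else 0)"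
      by (auto simp: indicator_def)
    ultimately have "((\<lambda>x. enn2real (k x)) has_integral (F b - F a)) {a..b}"
      using has_integral_restrict_UNIV[of "{a..b}" "\<lambda>x. enn2real (k x)"] by simp
    from has_integral_diff[OF this has_integral_const_real[of "L + 1" a b]]
    show "((\<lambda>x. enn2real (k x) - (L + 1)) has_integral (f b - f a)) {a..b}"
      using \<open>a \<le> b\<close> by (simp add: F_def algebra_simps)
  qed
qed

text \<open>
  The Lebesgue differentiation theorem for cubes with lower corner \<open>x\<close> is, on the line, a statement
  about right difference quotients. Left ones are reached by reflection.
\<close>

lemma indefinite_integral_right_derivative:
  fixes f g :: "real \<Rightarrow> real"
  assumes "\<And>a b. a \<le> b \<Longrightarrow> (g has_integral (f b - f a)) {a..b}"
  obtains N where "negligible N"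
    "\<And>x. x \<notin> N \<Longrightarrow> ((\<lambda>h. (f (x + h) - f x) / h) \<longlongrightarrow> g x) (at_right 0)"
proof -
  have "g integrable_on cbox a b" for a b
    by (cases "a \<le> b") (use assms in \<open>auto simp: integrable_on_def\<close>)
  from integrable_ccontinuous_explicit[OF this] obtain N where N: "negligible N"
    and lim: "\<And>x e. x \<notin> N \<Longrightarrow> 0 < e \<Longrightarrow> \<exists>d>0. \<forall>h. 0 < h \<and> h < d \<longrightarrow>
       norm (integral (cbox x (x + h *\<^sub>R One)) g /\<^sub>R h ^ DIM(real) - g x) < e"
    by blast
  show thesis
  proof (rule that[OF N])
    fix x assume x: "x \<notin> N"
    show "((\<lambda>h. (f (x + h) - f x) / h) \<longlongrightarrow> g x) (at_right 0)"
    proof (rule tendstoI)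
      fix e :: real assume "0 < e"
      from lim[OF x this] obtain d where "d > 0"
        and d: "\<And>h. 0 < h \<Longrightarrow> h < d \<Longrightarrow> norm (integral (cbox x (x + h *\<^sub>R One)) g /\<^sub>R h ^ DIM(real) - g x) < e"
        by blast
      have "dist ((f (x + h) - f x) / h) (g x) < e" if "0 < h" "h < d" for h
        using d[OF that] integral_unique[OF assms[of x "x + h"]] that
        by (simp add: dist_real_def divide_inverse_commute)
      then show "\<forall>\<^sub>F h in at_right 0. dist ((f (x + h) - f x) / h) (g x) < e"
        unfolding eventually_at_right_field using \<open>d > 0\<close> by auto
    qed
  qed
qed

text \<open>
  The reflected function must be given the reflected density, not a density of its own: only then
  do the left and right derivatives share the value \<open>g x\<close>.
\<close>

lemma lipschitz_real_differentiable_AE: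
  fixes f :: "real \<Rightarrow> real"
  assumes lip: "L-lipschitz_on UNIV f"
  shows "AE x in lborel. \<exists>D. ((\<lambda>h. (f (x + h) - f x) / h) \<longlongrightarrow> D) (at 0)"
proof -
  obtain g where g: "\<And>a b. a \<le> b \<Longrightarrow> (g has_integral (f b - f a)) {a..b}"
    using lipschitz_real_has_density[OF lip] by blast
  obtain N where N: "negligible N"
    and right: "\<And>x. x \<notin> N \<Longrightarrow> ((\<lambda>h. (f (x + h) - f x) / h) \<longlongrightarrow> g x) (at_right 0)"
    using indefinite_integral_right_derivative[OF g] by blast
  have "((\<lambda>x. g (- x)) has_integral (- f (- b) - - f (- a))) {a..b}" if "a \<le> b" for a b
    using g[of "- b" "- a"] that has_integral_reflect_real[of "\<lambda>x. g (- x)" "f (- a) - f (- b)" b a] by simp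
  from indefinite_integral_right_derivative[of "\<lambda>x. g (- x)" "\<lambda>x. - f (- x)", OF this]
  obtain M where M: "negligible M"
    and left: "\<And>x. x \<notin> M \<Longrightarrow> ((\<lambda>h. (- f (- (x + h)) - - f (- x)) / h) \<longlongrightarrow> g (- x)) (at_right 0)"
    by blast
  have "negligible (uminus ` M)"
    using M by (rule negligible_locally_Lipschitz_image[rotated])
      (auto intro!: exI[of _ "UNIV :: real set"] exI[of _ "1 :: real"])
  with N have "negligible (N \<union> uminus ` M)"
    by (rule negligible_Un)
  then have "N \<union> uminus ` M \<in> null_sets lebesgue"
    by (simp add: negligible_iff_null_sets)
  then have "AE x in lebesgue. \<exists>D. ((\<lambda>h. (f (x + h) - f x) / h) \<longlongrightarrow> D) (at 0)"
  proof (rule AE_I')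
    have "\<exists>D. ((\<lambda>h. (f (x + h) - f x) / h) \<longlongrightarrow> D) (at 0)" if x: "x \<notin> N \<union> uminus ` M" for x
    proof -
      have "- x \<notin> M" using x by force
      from left[OF this] have "((\<lambda>h. (f (x - h) - f x) / (- h)) \<longlongrightarrow> g x) (at_right 0)"
        by (simp add: minus_divide_left algebra_simps)
      then have "((\<lambda>h. (f (x + h) - f x) / h) \<longlongrightarrow> g x) (at_left 0)"
        unfolding filterlim_at_left_to_right[of _ _ "0::real"] by (simp add: algebra_simps)
      with right[of x] x show ?thesis
        by (auto intro: filterlim_split_at)
    qed
    then show "{x \<in> space lebesgue. \<nexists>D. ((\<lambda>h. (f (x + h) - f x) / h) \<longlongrightarrow> D) (at 0)} \<subseteq> N \<union> uminus ` M"
      by blast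
  qed
  then show ?thesis by (simp add: AE_completion_iff)
qed

section \<open>Directional derivatives\<close>

definition dir_quot :: "('a::real_vector \<Rightarrow> real) \<Rightarrow> 'a \<Rightarrow> 'a \<Rightarrow> real \<Rightarrow> real" where
  "dir_quot f x v t = (f (x + t *\<^sub>R v) - f x) / t"

text \<open>
  The limit is taken along a fixed sequence, so that the directional derivative is a Borel function
  defined at every point; it is meaningful only where the quotients converge (see \<open>dir_derivI\<close>).
\<close>

definition dir_deriv :: "('a::real_vector \<Rightarrow> real) \<Rightarrow> 'a \<Rightarrow> 'a \<Rightarrow> real" where
  "dir_deriv f x v = lim (\<lambda>n. dir_quot f x v (1 / real (Suc n)))"

lemma inverse_Suc_filterlim_at_0: "filterlim (\<lambda>n. 1 / real (Suc n)) (at 0) sequentially"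
  using LIMSEQ_inverse_real_of_nat by (simp add: filterlim_at inverse_eq_divide)

lemma dir_derivI: "(dir_quot f x v \<longlongrightarrow> D) (at 0) \<Longrightarrow> dir_deriv f x v = D"
  unfolding dir_deriv_def
  by (rule limI) (rule filterlim_compose[OF _ inverse_Suc_filterlim_at_0])

lemma lipschitz_dir_quot_bound:
  fixes f :: "'a::real_normed_vector \<Rightarrow> real"
  assumes "L-lipschitz_on S f" "x \<in> S" "x + t *\<^sub>R v \<in> S"
  shows "\<bar>dir_quot f x v t\<bar> \<le> L * norm v"
proof (cases "t = 0")
  case False
  have "\<bar>f (x + t *\<^sub>R v) - f x\<bar> \<le> (L * norm v) * \<bar>t\<bar>"
    using lipschitz_onD[OF assms(1,3,2)] by (simp add: dist_norm ac_simps)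
  then show ?thesis
    using False by (simp add: dir_quot_def abs_divide divide_le_eq)
qed (use lipschitz_on_nonneg[OF assms(1)] in \<open>simp add: dir_quot_def\<close>)

text \<open>
  The Cauchy form of the existence of a limit has no quantifier over the limit value. Its
  innermost condition is closed in any parameter on which \<open>q\<close> depends continuously, which is what
  makes the domain of a directional derivative a Borel set.
\<close>

lemma real_limit_at_0_iff_Cauchy:
  fixes q :: "real \<Rightarrow> real"
  shows "(\<exists>D. (q \<longlongrightarrow> D) (at 0)) \<longleftrightarrow>
    (\<forall>n. \<exists>m. \<forall>s t. s \<noteq> 0 \<and> t \<noteq> 0 \<and> \<bar>s\<bar> < 1 / real (Suc m) \<and> \<bar>t\<bar> < 1 / real (Suc m) \<longrightarrow>
       \<bar>q s - q t\<bar> \<le> 1 / real (Suc n))" (is "?lim \<longleftrightarrow> ?Cauchy")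
proof
  assume ?lim
  then obtain D where D: "(q \<longlongrightarrow> D) (at 0)" by blast
  show ?Cauchy
  proof
    fix n
    define e where "e = 1 / real (Suc n)"
    have "e > 0" by (simp add: e_def)
    have "\<forall>\<^sub>F s in at 0. dist (q s) D < e / 2"
      using D by (rule tendstoD) (simp add: \<open>e > 0\<close>)
    then obtain d where "d > 0" and d: "\<And>s. s \<noteq> 0 \<Longrightarrow> \<bar>s\<bar> < d \<Longrightarrow> \<bar>q s - D\<bar> < e / 2"
      unfolding eventually_at by (auto simp: dist_real_def)
    obtain m where m: "1 / real (Suc m) < d"
      using \<open>d > 0\<close> nat_approx_posE by blast
    have "\<bar>q s - q t\<bar> \<le> e"
      if "s \<noteq> 0" "t \<noteq> 0" "\<bar>s\<bar> < 1 / real (Suc m)" "\<bar>t\<bar> < 1 / real (Suc m)" for s t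
      using d[OF that(1) less_trans[OF that(3) m]] d[OF that(2) less_trans[OF that(4) m]]
      by linarith
    then show "\<exists>m. \<forall>s t. s \<noteq> 0 \<and> t \<noteq> 0 \<and> \<bar>s\<bar> < 1 / real (Suc m) \<and> \<bar>t\<bar> < 1 / real (Suc m) \<longrightarrow>
       \<bar>q s - q t\<bar> \<le> 1 / real (Suc n)"
      unfolding e_def by blast
  qed
next
  assume C: ?Cauchy
  define r where "r = (\<lambda>n. q (1 / real (Suc n)))"
  have "Cauchy r"
  proof (rule metric_CauchyI)
    fix e :: real assume "0 < e"
    then obtain n where n: "1 / real (Suc n) < e" using nat_approx_posE by blast
    obtain m where m: "\<And>s t. s \<noteq> 0 \<Longrightarrow> t \<noteq> 0 \<Longrightarrow> \<bar>s\<bar> < 1 / real (Suc m) \<Longrightarrow> \<bar>t\<bar> < 1 / real (Suc m) \<Longrightarrow>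
       \<bar>q s - q t\<bar> \<le> 1 / real (Suc n)" using C by meson
    have "dist (r i) (r j) < e" if "i \<ge> Suc m" "j \<ge> Suc m" for i j
      using m[of "1 / real (Suc i)" "1 / real (Suc j)"] that n
      by (auto simp: r_def dist_real_def frac_less2)
    then show "\<exists>M. \<forall>i\<ge>M. \<forall>j\<ge>M. dist (r i) (r j) < e" by blast
  qed
  then obtain D where D: "r \<longlonglongrightarrow> D"
    using Cauchy_convergent_iff convergent_def by blast
  have "(q \<longlongrightarrow> D) (at 0)"
  proof (rule tendstoI)
    fix e :: real assume "0 < e"
    then obtain n where n: "1 / real (Suc n) < e" using nat_approx_posE by blast
    obtain m where m: "\<And>s t. s \<noteq> 0 \<Longrightarrow> t \<noteq> 0 \<Longrightarrow> \<bar>s\<bar> < 1 / real (Suc m) \<Longrightarrow> \<bar>t\<bar> < 1 / real (Suc m) \<Longrightarrow>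
       \<bar>q s - q t\<bar> \<le> 1 / real (Suc n)" using C by meson
    have "dist (q s) D < e" if s: "s \<noteq> 0" "\<bar>s\<bar> < 1 / real (Suc m)" for s
    proof -
      have "(\<lambda>i. \<bar>q s - r i\<bar>) \<longlonglongrightarrow> \<bar>q s - D\<bar>"
        by (intro tendsto_intros D)
      moreover have "\<forall>i\<ge>Suc m. \<bar>q s - r i\<bar> \<le> 1 / real (Suc n)"
        using m[of s] s by (auto simp: r_def frac_less2)
      ultimately have "\<bar>q s - D\<bar> \<le> 1 / real (Suc n)"
        by (rule LIMSEQ_le_const2[OF _ exI])
      then show ?thesis using n by (simp add: dist_real_def)
    qed
    then show "\<forall>\<^sub>F s in at 0. dist (q s) D < e"
      unfolding eventually_at by (intro exI[of _ "1 / real (Suc m)"]) (auto simp: dist_real_def)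
  qed
  then show ?lim by blast
qed

lemma AE_lborel_affine:
  fixes P :: "'a::euclidean_space \<Rightarrow> bool"
  assumes "c \<noteq> 0" "Measurable.pred borel P" "AE x in lborel. P x"
  shows "AE x in lborel. P (t + c *\<^sub>R x)"
  using assms
  by (subst lborel_affine[where t="- (1 / c) *\<^sub>R t" and c="1 / c"])
     (simp_all add: AE_density AE_distr_iff algebra_simps)

lemma borel_pred_dir_limit:
  fixes f :: "'a::euclidean_space \<Rightarrow> real"
  assumes "continuous_on UNIV f"
  shows "Measurable.pred borel (\<lambda>x. \<exists>D. (dir_quot f x v \<longlongrightarrow> D) (at 0))"
proof -
  have [measurable]: "Measurable.pred borel (\<lambda>x. \<forall>s t. s \<noteq> 0 \<and> t \<noteq> 0 \<and> \<bar>s\<bar> < 1 / real (Suc m) \<and> \<bar>t\<bar> < 1 / real (Suc m) \<longrightarrow>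
       \<bar>dir_quot f x v s - dir_quot f x v t\<bar> \<le> 1 / real (Suc n))" for m n
  proof -
    have "closed {x. \<bar>dir_quot f x v s - dir_quot f x v t\<bar> \<le> 1 / real (Suc n)}" if "s \<noteq> 0" "t \<noteq> 0" for s t
      unfolding dir_quot_def using that
      by (intro closed_Collect_le continuous_intros continuous_on_compose2[OF assms]) auto
    then have "closed {x. s \<noteq> 0 \<and> t \<noteq> 0 \<and> \<bar>s\<bar> < 1 / real (Suc m) \<and> \<bar>t\<bar> < 1 / real (Suc m) \<longrightarrow>
       \<bar>dir_quot f x v s - dir_quot f x v t\<bar> \<le> 1 / real (Suc n)}" for s t
      by (cases "s \<noteq> 0 \<and> t \<noteq> 0 \<and> \<bar>s\<bar> < 1 / real (Suc m) \<and> \<bar>t\<bar> < 1 / real (Suc m)") auto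
    then show ?thesis
      unfolding pred_def by (auto intro!: borel_closed closed_Collect_all)
  qed
  show ?thesis
    unfolding real_limit_at_0_iff_Cauchy by measurable
qed

text \<open>
  On every line parallel to \<open>v\<close> the exceptional set is null by the one-dimensional case. Exchanging
  the order of quantifiers (Tonelli) shows that for some shift \<open>t\<close> the exceptional set translated by
  \<open>- t v\<close> is null, and Lebesgue measure is translation invariant. No rotation of coordinates is
  involved, and \<open>v = 0\<close> is covered as well.
\<close>

lemma lipschitz_dir_limit_AE:
  fixes f :: "'a::euclidean_space \<Rightarrow> real"
  assumes lip: "L-lipschitz_on UNIV f"
  shows "AE x in lborel. \<exists>D. (dir_quot f x v \<longlongrightarrow> D) (at 0)"
proof -
  let ?P = "\<lambda>x. \<exists>D. (dir_quot f x v \<longlongrightarrow> D) (at 0)"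
  have [measurable]: "Measurable.pred borel ?P"
    by (rule borel_pred_dir_limit[OF lipschitz_on_continuous_on[OF lip]])
  have line: "AE t in lborel. ?P (x + t *\<^sub>R v)" for x
  proof -
    have "(L * norm v)-lipschitz_on UNIV (\<lambda>t. f (x + t *\<^sub>R v))"
    proof (rule lipschitz_onI)
      fix s t :: real
      have "dist (f (x + s *\<^sub>R v)) (f (x + t *\<^sub>R v)) \<le> L * dist (x + s *\<^sub>R v) (x + t *\<^sub>R v)"
        by (rule lipschitz_onD[OF lip]) auto
      also have "\<dots> = L * norm v * dist s t"
        by (simp add: dist_norm scaleR_diff_left[symmetric] ac_simps)
      finally show "dist (f (x + s *\<^sub>R v)) (f (x + t *\<^sub>R v)) \<le> L * norm v * dist s t" .
    qed (use lipschitz_on_nonneg[OF lip] in auto)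
    from lipschitz_real_differentiable_AE[OF this] show ?thesis
      by (simp add: dir_quot_def[abs_def] scaleR_add_left add.assoc)
  qed
  have "AE x in lborel. AE t in lborel. ?P (x + t *\<^sub>R v)"
    using line by simp
  then have "AE t::real in lborel. AE x in lborel. ?P (x + t *\<^sub>R v)"
    by (subst (asm) lborel_pair.AE_commute) measurable
  then have "\<exists>t::real. AE x in lborel. ?P (x + t *\<^sub>R v)"
    by (rule eventually_happens'[rotated]) (simp add: ae_filter_eq_bot_iff)
  then obtain t :: real where "AE x in lborel. ?P (x + t *\<^sub>R v)" ..
  then have "AE x in lborel. ?P ((- t *\<^sub>R v + 1 *\<^sub>R x) + t *\<^sub>R v)"
    by (rule AE_lborel_affine[rotated 2]) auto
  then show ?thesis by simp
qed

text \<open>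
  The pointwise convergence that dominated convergence asks for when the domain of integration
  moves; it fails only on the frontier, which is null for convex sets.
\<close>

lemma indicator_translate_tendsto:
  fixes y :: "'a::real_normed_vector"
  assumes y: "y \<notin> frontier K" and c: "(c \<longlongrightarrow> y) F"
  shows "((\<lambda>n. indicator K (c n) :: real) \<longlongrightarrow> indicator K y) F"
proof (cases "y \<in> interior K")
  case True
  from topological_tendstoD[OF c open_interior this] have "\<forall>\<^sub>F n in F. indicator K (c n) = (indicator K y :: real)"
    by eventually_elim (use True interior_subset in \<open>auto simp: indicator_def\<close>)
  then show ?thesis by (rule tendsto_eventually)
next
  case False
  then have "y \<in> - closure K" using y by (auto simp: frontier_def)
  from topological_tendstoD[OF c open_Compl[OF closed_closure] this] have "\<forall>\<^sub>F n in F. indicator K (c n) = (indicator K y :: real)"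
    by eventually_elim (use \<open>y \<in> - closure K\<close> closure_subset in \<open>auto simp: indicator_def\<close>)
  then show ?thesis by (rule tendsto_eventually)
qed

lemma integral_lborel_translate:
  fixes g :: "'a::euclidean_space \<Rightarrow> 'b::{banach, second_countable_topology}"
  assumes "g \<in> borel_measurable borel"
  shows "(LINT x|lborel. g (c + x)) = (LINT x|lborel. g x)"
  using assms integral_distr[of "(+) c" lborel borel g] by (simp add: lborel_distr_plus)

section \<open>Linearity of directional derivatives\<close>

lemma borel_measurable_dir_quot:
  fixes f :: "'a::euclidean_space \<Rightarrow> real"
  assumes "continuous_on UNIV f"
  shows "(\<lambda>x. dir_quot f x v t) \<in> borel_measurable borel"
  unfolding dir_quot_def[abs_def] divide_inverse
  by (intro borel_measurable_continuous_onI continuous_intros continuous_on_compose2[OF assms]) auto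

lemma borel_measurable_dir_deriv:
  fixes f :: "'a::euclidean_space \<Rightarrow> real"
  assumes "continuous_on UNIV f"
  shows "(\<lambda>x. dir_deriv f x v) \<in> borel_measurable borel"
  unfolding dir_deriv_def[abs_def]
  by (intro borel_measurable_lim_metric borel_measurable_dir_quot assms)

lemma integrable_indicator_bounded_AE:
  fixes g :: "'a::euclidean_space \<Rightarrow> real"
  assumes "K \<in> sets borel" "bounded K" "g \<in> borel_measurable borel" "AE x in lborel. \<bar>g x\<bar> \<le> B"
  shows "integrable lborel (\<lambda>x. indicator K x * g x)"
proof (rule Bochner_Integration.integrable_bound)
  show "integrable lborel (\<lambda>x. B * indicator K x)"
    using assms emeasure_bounded_finite[of K] by (intro integrable_mult_right integrable_real_indicator) auto
  show "AE x in lborel. norm (indicator K x * g x) \<le> norm (B * indicator K x :: real)"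
    using assms(4) by eventually_elim (auto simp: indicator_def)
qed (use assms in measurable)

lemma lipschitz_dir_deriv_bound_AE:
  fixes f :: "'a::euclidean_space \<Rightarrow> real"
  assumes lip: "L-lipschitz_on UNIV f"
  shows "AE x in lborel. \<bar>dir_deriv f x v\<bar> \<le> L * norm v"
  using lipschitz_dir_limit_AE[OF lip, of v]
proof eventually_elim
  case (elim x)
  then have "(dir_quot f x v \<longlongrightarrow> dir_deriv f x v) (at 0)"
    using dir_derivI by blast
  then have "((\<lambda>t. \<bar>dir_quot f x v t\<bar>) \<longlongrightarrow> \<bar>dir_deriv f x v\<bar>) (at 0)"
    by (rule tendsto_rabs)
  then show ?case
    by (rule tendsto_upperbound) (use lipschitz_dir_quot_bound[OF lip] in auto)
qed

text \<open>
  The base point of the quotient moves with \<open>n\<close>, so its pointwise limit is out of reach.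
  Translating the integral fixes the base point and moves the set \<open>K\<close> instead, which is harmless.
  The case \<open>u = 0\<close> is the plain convergence of the quotients.
\<close>

lemma lipschitz_dir_deriv_integral_limit:
  fixes f :: "'a::euclidean_space \<Rightarrow> real"
  assumes lip: "L-lipschitz_on UNIV f"
    and K: "convex K" "bounded K" "K \<in> sets borel"
  shows "(\<lambda>n. LINT x|lborel. indicator K x * dir_quot f (x + (1 / real (Suc n)) *\<^sub>R u) v (1 / real (Suc n)))
    \<longlonglongrightarrow> (LINT x|lborel. indicator K x * dir_deriv f x v)"
proof -
  define t where "t = (\<lambda>n. 1 / real (Suc n))"
  have t01: "0 \<le> t n" "t n \<le> 1" for n by (auto simp: t_def)
  have t_lim: "filterlim t (at 0) sequentially"
    unfolding t_def by (rule inverse_Suc_filterlim_at_0)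
  then have t0: "t \<longlonglongrightarrow> 0" by (simp add: filterlim_at)
  have cont: "continuous_on UNIV f"
    using lip by (rule lipschitz_on_continuous_on)
  note [measurable] = borel_measurable_dir_quot[OF cont] borel_measurable_dir_deriv[OF cont] K(3)
  obtain R where R: "\<And>x. x \<in> K \<Longrightarrow> norm x \<le> R"
    using K(2) unfolding bounded_iff by blast
  have shift: "(LINT x|lborel. indicator K x * dir_quot f (x + t n *\<^sub>R u) v (t n))
      = (LINT y|lborel. indicator K (y - t n *\<^sub>R u) * dir_quot f y v (t n))" for n
    using integral_lborel_translate[of "\<lambda>y. indicator K (y - t n *\<^sub>R u) * dir_quot f y v (t n)" "t n *\<^sub>R u"]
    by (simp add: add.commute)
  have "(\<lambda>n. LINT y|lborel. indicator K (y - t n *\<^sub>R u) * dir_quot f y v (t n))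
      \<longlonglongrightarrow> (LINT y|lborel. indicator K y * dir_deriv f y v)"
  proof (rule integral_dominated_convergence[where w="\<lambda>y. L * norm v * indicator (cball 0 (R + norm u)) y"])
    show "integrable lborel (\<lambda>y::'a. L * norm v * indicator (cball 0 (R + norm u)) y)"
      using emeasure_bounded_finite[of "cball (0::'a) (R + norm u)"]
      by (intro integrable_mult_right integrable_real_indicator) auto
    have "frontier K \<in> null_sets lborel"
      using negligible_convex_frontier[OF K(1)]
      by (simp add: negligible_iff_null_sets null_sets_completion_iff)
    then have "AE y in lborel. y \<notin> frontier K" by (rule AE_not_in)
    with lipschitz_dir_limit_AE[OF lip, of v]
    show "AE y in lborel. (\<lambda>n. indicator K (y - t n *\<^sub>R u) * dir_quot f y v (t n))
        \<longlonglongrightarrow> indicator K y * dir_deriv f y v"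
    proof eventually_elim
      case (elim y)
      then have "(dir_quot f y v \<longlongrightarrow> dir_deriv f y v) (at 0)"
        using dir_derivI by blast
      then have "(\<lambda>n. dir_quot f y v (t n)) \<longlonglongrightarrow> dir_deriv f y v"
        by (rule filterlim_compose[OF _ t_lim])
      moreover have "(\<lambda>n. y - t n *\<^sub>R u) \<longlonglongrightarrow> y - 0 *\<^sub>R u"
        by (intro tendsto_intros t0)
      then have "(\<lambda>n. indicator K (y - t n *\<^sub>R u) :: real) \<longlonglongrightarrow> indicator K y"
        using elim by (intro indicator_translate_tendsto) simp_all
      ultimately show ?case by (intro tendsto_mult)
    qed
    show "AE y in lborel. norm (indicator K (y - t n *\<^sub>R u) * dir_quot f y v (t n))
        \<le> L * norm v * indicator (cball 0 (R + norm u)) y" for n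
    proof (rule AE_I2)
      fix y :: 'a
      have "norm y \<le> R + norm u" if "y - t n *\<^sub>R u \<in> K"
      proof -
        have "norm y \<le> norm (y - t n *\<^sub>R u) + norm (t n *\<^sub>R u)"
          using norm_triangle_ineq[of "y - t n *\<^sub>R u" "t n *\<^sub>R u"] by simp
        also have "\<dots> \<le> R + norm u"
          using R[OF that] t01[of n] by (intro add_mono) (auto simp: mult_left_le_one_le)
        finally show ?thesis .
      qed
      then show "norm (indicator K (y - t n *\<^sub>R u) * dir_quot f y v (t n))
        \<le> L * norm v * indicator (cball 0 (R + norm u)) y"
        using lipschitz_dir_quot_bound[OF lip, of y "t n" v] lipschitz_on_nonneg[OF lip]
        by (auto simp: indicator_def)
    qed
  qed measurable
  then show ?thesis unfolding shift[symmetric] unfolding t_def .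
qed

text \<open>
  By the Lebesgue differentiation theorem \<open>g x\<close> is almost everywhere the limit of its cube
  averages.
\<close>

lemma AE_zero_if_cube_integrals_zero:
  fixes g :: "'a::euclidean_space \<Rightarrow> real"
  assumes int: "\<And>a b. integrable lborel (\<lambda>x. indicator (cbox a b) x * g x)"
    and zero: "\<And>a b. (LINT x|lborel. indicator (cbox a b) x * g x) = 0"
  shows "AE x in lborel. g x = 0"
proof -
  have set_int: "set_integrable lborel (cbox a b) g" for a b
    using int[of a b] by (simp add: set_integrable_def)
  have "g integrable_on cbox a b" "integral (cbox a b) g = 0" for a b
    using set_borel_integral_eq_integral[OF set_int[of a b]] zero[of a b]
    by (auto simp: set_lebesgue_integral_def)
  note g = this
  from integrable_ccontinuous_explicit[OF this(1)] obtain N where N: "negligible N"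
    and lim: "\<And>x e. x \<notin> N \<Longrightarrow> 0 < e \<Longrightarrow> \<exists>d>0. \<forall>h. 0 < h \<and> h < d \<longrightarrow>
       norm (integral (cbox x (x + h *\<^sub>R One)) g /\<^sub>R h ^ DIM('a) - g x) < e"
    by blast
  have "g x = 0" if x: "x \<notin> N" for x
  proof (rule ccontr)
    assume "g x \<noteq> 0"
    then obtain d where "d > 0" and
      "\<forall>h. 0 < h \<and> h < d \<longrightarrow> norm (integral (cbox x (x + h *\<^sub>R One)) g /\<^sub>R h ^ DIM('a) - g x) < \<bar>g x\<bar>"
      using lim[OF x, of "\<bar>g x\<bar>"] by auto
    from this(2)[rule_format, of "d / 2"] \<open>d > 0\<close> show False
      unfolding g(2) by simp
  qed
  then have "AE x in lebesgue. g x = 0"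
    using N by (intro AE_I'[of N]) (auto simp: negligible_iff_null_sets)
  then show ?thesis by (simp add: AE_completion_iff)
qed

text \<open>
  Pointwise, the quotient in direction \<open>u + v\<close> is the quotient in direction \<open>u\<close> at \<open>x\<close> plus the one
  in direction \<open>v\<close> at \<open>x + s u\<close>. Integration over cubes removes the moving base point in the limit.
\<close>

lemma lipschitz_dir_deriv_add_AE:
  fixes f :: "'a::euclidean_space \<Rightarrow> real"
  assumes lip: "L-lipschitz_on UNIV f"
  shows "AE x in lborel. dir_deriv f x (u + v) = dir_deriv f x u + dir_deriv f x v"
proof -
  let ?I = "\<lambda>a b g. LINT x|lborel. indicator (cbox a b) x * g x"
  have cont: "continuous_on UNIV f"
    using lip by (rule lipschitz_on_continuous_on)
  have int_quot: "integrable lborel (\<lambda>x. indicator (cbox a b) x * dir_quot f (x + c) w t)" for a b c w t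
  proof (rule integrable_indicator_bounded_AE)
    show "(\<lambda>x. dir_quot f (x + c) w t) \<in> borel_measurable borel"
      using measurable_compose[OF _ borel_measurable_dir_quot[OF cont, of w t], of "\<lambda>x. x + c"] by simp
    show "AE x in lborel. \<bar>dir_quot f (x + c) w t\<bar> \<le> L * norm w"
      using lipschitz_dir_quot_bound[OF lip] by simp
  qed auto
  have int_deriv: "integrable lborel (\<lambda>x. indicator (cbox a b) x * dir_deriv f x w)" for a b w
    by (rule integrable_indicator_bounded_AE[OF _ _ borel_measurable_dir_deriv[OF cont]
          lipschitz_dir_deriv_bound_AE[OF lip]]) auto
  have "AE x in lborel. dir_deriv f x (u + v) - (dir_deriv f x u + dir_deriv f x v) = 0"
  proof (rule AE_zero_if_cube_integrals_zero)
    fix a b :: 'a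
    show "integrable lborel (\<lambda>x. indicator (cbox a b) x * (dir_deriv f x (u + v) - (dir_deriv f x u + dir_deriv f x v)))"
      unfolding right_diff_distrib distrib_left
      by (intro Bochner_Integration.integrable_diff Bochner_Integration.integrable_add int_deriv)
    define t where "t = (\<lambda>n. 1 / real (Suc n))"
    have lim: "(\<lambda>n. ?I a b (\<lambda>x. dir_quot f (x + t n *\<^sub>R u') w (t n))) \<longlonglongrightarrow> ?I a b (\<lambda>x. dir_deriv f x w)" for u' w
      unfolding t_def by (rule lipschitz_dir_deriv_integral_limit[OF lip]) auto
    have split: "dir_quot f x (u + v) s = dir_quot f x u s + dir_quot f (x + s *\<^sub>R u) v s" for x s
      by (simp add: dir_quot_def scaleR_add_right add.assoc diff_divide_distrib)
    have "?I a b (\<lambda>x. dir_quot f x (u + v) (t n))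
        = ?I a b (\<lambda>x. dir_quot f x u (t n)) + ?I a b (\<lambda>x. dir_quot f (x + t n *\<^sub>R u) v (t n))" for n
      unfolding split distrib_left
      using int_quot[of a b 0 u "t n"] int_quot[of a b "t n *\<^sub>R u" v "t n"]
      by (intro Bochner_Integration.integral_add) auto
    then have "(\<lambda>n. ?I a b (\<lambda>x. dir_quot f x (u + v) (t n)))
        \<longlonglongrightarrow> ?I a b (\<lambda>x. dir_deriv f x u) + ?I a b (\<lambda>x. dir_deriv f x v)"
      using tendsto_add[OF lim[of 0 u] lim[of u v]] by simp
    moreover have "(\<lambda>n. ?I a b (\<lambda>x. dir_quot f x (u + v) (t n))) \<longlonglongrightarrow> ?I a b (\<lambda>x. dir_deriv f x (u + v))"
      using lim[of 0 "u + v"] by simp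
    ultimately have "?I a b (\<lambda>x. dir_deriv f x (u + v))
        = ?I a b (\<lambda>x. dir_deriv f x u) + ?I a b (\<lambda>x. dir_deriv f x v)"
      using LIMSEQ_unique by blast
    then show "?I a b (\<lambda>x. dir_deriv f x (u + v) - (dir_deriv f x u + dir_deriv f x v)) = 0"
      by (simp add: right_diff_distrib distrib_left int_deriv)
  qed
  then show ?thesis by simp
qed

lemma dir_quot_scale_tendsto:
  assumes "(dir_quot f x v \<longlongrightarrow> D) (at 0)"
  shows "(dir_quot f x (c *\<^sub>R v) \<longlongrightarrow> c * D) (at 0)"
proof (cases "c = 0")
  case True
  then show ?thesis by (simp add: dir_quot_def[abs_def])
next
  case False
  have "filterlim (\<lambda>t. c * t) (at 0) (at 0)"
    using False by (auto simp: filterlim_at eventually_at intro!: tendsto_eq_intros exI[of _ 1])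
  from filterlim_compose[OF assms this]
  have "((\<lambda>t. c * dir_quot f x v (c * t)) \<longlongrightarrow> c * D) (at 0)"
    by (rule tendsto_mult_left)
  moreover have "(\<lambda>t. c * dir_quot f x v (c * t)) = dir_quot f x (c *\<^sub>R v)"
    using False by (auto simp: dir_quot_def fun_eq_iff mult.commute)
  ultimately show ?thesis by simp
qed

lemma lipschitz_dir_deriv_sum_AE:
  fixes f :: "'a::euclidean_space \<Rightarrow> real"
  assumes lip: "L-lipschitz_on UNIV f" and "finite B"
  shows "AE x in lborel. dir_deriv f x (\<Sum>b\<in>B. c b *\<^sub>R b) = (\<Sum>b\<in>B. c b * dir_deriv f x b)"
  using \<open>finite B\<close>
proof induction
  case empty
  have "dir_deriv f x 0 = 0" for x
    by (rule dir_derivI) (simp add: dir_quot_def[abs_def])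
  then show ?case by simp
next
  case (insert b B)
  from insert.IH lipschitz_dir_deriv_add_AE[OF lip, of "c b *\<^sub>R b" "\<Sum>b\<in>B. c b *\<^sub>R b"]
    lipschitz_dir_limit_AE[OF lip, of b]
  show ?case
  proof eventually_elim
    case (elim x)
    then have "(dir_quot f x b \<longlongrightarrow> dir_deriv f x b) (at 0)"
      using dir_derivI by blast
    then have "dir_deriv f x (c b *\<^sub>R b) = c b * dir_deriv f x b"
      by (intro dir_derivI dir_quot_scale_tendsto)
    then show ?case
      using elim insert.hyps by simp
  qed
qed

section \<open>Rademacher's theorem\<close>

text \<open>
  Finitely many directions of the dense set form an \<open>\<epsilon>\<close>-net of the unit sphere, so the quotients
  converge uniformly on the net. Replacing an arbitrary unit direction by its neighbour in the net
  costs at most \<open>(L + |G|) \<epsilon>\<close>.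
\<close>

lemma lipschitz_differentiable_if_linear_on_dense:
  fixes f :: "'a::euclidean_space \<Rightarrow> real"
  assumes "r > 0" and lip: "L-lipschitz_on (ball x r) f"
    and dense: "\<And>X::'a set. open X \<Longrightarrow> X \<noteq> {} \<Longrightarrow> \<exists>q\<in>S. q \<in> X"
    and lim: "\<And>q. q \<in> S \<Longrightarrow> (dir_quot f x q \<longlongrightarrow> G \<bullet> q) (at 0)"
  shows "GDERIV f x :> G"
proof -
  have L0: "0 \<le> L" using lip by (rule lipschitz_on_nonneg)
  have "\<exists>d>0. \<forall>y. norm (y - x) < d \<longrightarrow> norm (f y - f x - (y - x) \<bullet> G) \<le> e * norm (y - x)"
    if "e > 0" for e
  proof -
    define \<epsilon> where "\<epsilon> = e / (L + norm G + 1)"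
    have "\<epsilon> > 0" unfolding \<epsilon>_def using that L0 by (intro divide_pos_pos) (auto intro: add_nonneg_pos)
    have "sphere (0::'a) 1 \<subseteq> (\<Union>q\<in>S. ball q \<epsilon>)"
    proof
      fix u :: 'a
      obtain q where "q \<in> S" "q \<in> ball u \<epsilon>"
        using dense[of "ball u \<epsilon>"] \<open>\<epsilon> > 0\<close> by auto
      then show "u \<in> (\<Union>q\<in>S. ball q \<epsilon>)"
        by (auto simp: dist_commute)
    qed
    then obtain Q where Q: "Q \<subseteq> S" "finite Q" "sphere (0::'a) 1 \<subseteq> (\<Union>q\<in>Q. ball q \<epsilon>)"
      using compactE_image[OF compact_sphere, of S "\<lambda>q. ball q \<epsilon>"] by blast
    have "\<forall>\<^sub>F t in at 0. \<forall>q\<in>Q. dist (dir_quot f x q t) (G \<bullet> q) < \<epsilon>"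
      using Q lim \<open>\<epsilon> > 0\<close> by (intro eventually_ball_finite) (auto intro!: tendstoD)
    then obtain d0 where "d0 > 0"
      and d0: "\<And>t q. t \<noteq> 0 \<Longrightarrow> \<bar>t\<bar> < d0 \<Longrightarrow> q \<in> Q \<Longrightarrow> \<bar>dir_quot f x q t - G \<bullet> q\<bar> < \<epsilon>"
      unfolding eventually_at by (auto simp: dist_real_def)
    \<comment> \<open>The point \<open>q\<close> chosen below has norm less than \<open>1 + \<epsilon>\<close>; this keeps \<open>x + t q\<close> in the ball where \<open>f\<close> is Lipschitz.\<close>
    define d where "d = min d0 (r / (1 + \<epsilon>))"
    have "d > 0" using \<open>d0 > 0\<close> \<open>r > 0\<close> \<open>\<epsilon> > 0\<close> by (simp add: d_def)
    have "norm (f y - f x - (y - x) \<bullet> G) \<le> e * norm (y - x)" if y: "norm (y - x) < d" for y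
    proof (cases "y = x")
      case False
      define t where "t = norm (y - x)"
      define u where "u = (1 / t) *\<^sub>R (y - x)"
      have t: "t > 0" "t < d" using False y by (auto simp: t_def)
      have yx: "y = x + t *\<^sub>R u" using t by (simp add: u_def)
      have "u \<in> sphere 0 1" using t by (simp add: u_def t_def)
      then obtain q where q: "q \<in> Q" "dist q u < \<epsilon>"
        using Q(3) by auto
      have "t * (1 + \<epsilon>) < r"
        using t \<open>\<epsilon> > 0\<close> by (simp add: d_def pos_less_divide_eq)
      moreover have "norm u \<le> 1 + \<epsilon>" "norm q \<le> 1 + \<epsilon>"
        using \<open>u \<in> sphere 0 1\<close> q(2) \<open>\<epsilon> > 0\<close> norm_triangle_ineq2[of q u] by (auto simp: dist_norm)
      ultimately have "t * norm u < r" "t * norm q < r"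
        using t by (meson mult_left_mono less_imp_le le_less_trans)+
      then have "x + t *\<^sub>R u \<in> ball x r" "x + t *\<^sub>R q \<in> ball x r"
        using t by (auto simp: dist_norm)
      then have "\<bar>f (x + t *\<^sub>R u) - f (x + t *\<^sub>R q)\<bar> \<le> L * dist (x + t *\<^sub>R u) (x + t *\<^sub>R q)"
        using lipschitz_onD[OF lip, of "x + t *\<^sub>R u" "x + t *\<^sub>R q"] by (simp add: dist_real_def)
      also have "dist (x + t *\<^sub>R u) (x + t *\<^sub>R q) = t * dist q u"
        using t by (simp add: dist_norm norm_minus_commute scaleR_diff_right[symmetric])
      also have "L * (t * dist q u) \<le> L * (t * \<epsilon>)"
        using q t L0 by (intro mult_left_mono) auto
      finally have 1: "\<bar>f (x + t *\<^sub>R u) - f (x + t *\<^sub>R q)\<bar> \<le> L * (t * \<epsilon>)" .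
      have "f (x + t *\<^sub>R q) - f x - t * (G \<bullet> q) = t * (dir_quot f x q t - G \<bullet> q)"
        using t by (simp add: dir_quot_def field_simps)
      then have "\<bar>f (x + t *\<^sub>R q) - f x - t * (G \<bullet> q)\<bar> = t * \<bar>dir_quot f x q t - G \<bullet> q\<bar>"
        using t by (simp add: abs_mult)
      also have "\<dots> \<le> t * \<epsilon>"
        using d0[of t q] t q by (intro mult_left_mono) (auto simp: d_def)
      finally have 2: "\<bar>f (x + t *\<^sub>R q) - f x - t * (G \<bullet> q)\<bar> \<le> t * \<epsilon>" .
      have "\<bar>t * (G \<bullet> q) - t * (G \<bullet> u)\<bar> = t * \<bar>G \<bullet> (q - u)\<bar>"
        using t by (simp add: inner_diff_right abs_mult right_diff_distrib[symmetric])
      also have "\<dots> \<le> t * (norm G * \<epsilon>)"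
        using t q Cauchy_Schwarz_ineq2[of G "q - u"]
        by (intro mult_left_mono order_trans[OF Cauchy_Schwarz_ineq2]) (auto simp: dist_norm)
      finally have 3: "\<bar>t * (G \<bullet> q) - t * (G \<bullet> u)\<bar> \<le> t * (norm G * \<epsilon>)" .
      have "L * (t * \<epsilon>) + t * \<epsilon> + t * (norm G * \<epsilon>) = t * ((L + norm G + 1) * \<epsilon>)"
        by (simp add: algebra_simps)
      also have "(L + norm G + 1) * \<epsilon> = e"
        using L0 norm_ge_zero[of G] by (simp add: \<epsilon>_def add_nonneg_eq_0_iff)
      finally have "\<bar>f (x + t *\<^sub>R u) - f x - t * (G \<bullet> u)\<bar> \<le> t * e"
        using 1 2 3 by linarith
      then show ?thesis
        by (simp add: yx[symmetric] t_def[symmetric] mult.commute) (simp add: yx inner_commute)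
    qed auto
    then show ?thesis using \<open>d > 0\<close> by blast
  qed
  then show ?thesis
    unfolding gderiv_def has_derivative_at_alt
    by (auto intro: bounded_linear_inner_left)
qed

theorem lipschitz_differentiable_AE:
  fixes f :: "'a::euclidean_space \<Rightarrow> real"
  assumes lip: "L-lipschitz_on UNIV f"
  shows "AE x in lborel. f differentiable (at x)"
proof -
  obtain S :: "'a set" where "countable S"
    and dense: "\<And>X::'a set. open X \<Longrightarrow> X \<noteq> {} \<Longrightarrow> \<exists>q\<in>S. q \<in> X"
    using countable_dense_setE by blast
  have "AE x in lborel. \<forall>q\<in>S. (\<exists>D. (dir_quot f x q \<longlongrightarrow> D) (at 0)) \<and>
      dir_deriv f x (\<Sum>b\<in>Basis. (q \<bullet> b) *\<^sub>R b) = (\<Sum>b\<in>Basis. (q \<bullet> b) * dir_deriv f x b)"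
    unfolding AE_ball_countable[OF \<open>countable S\<close>] AE_conj_iff
    by (intro ballI conjI lipschitz_dir_limit_AE[OF lip] lipschitz_dir_deriv_sum_AE[OF lip]) auto
  then show ?thesis
  proof eventually_elim
    case (elim x)
    define G where "G = (\<Sum>b\<in>Basis. dir_deriv f x b *\<^sub>R b)"
    have "(dir_quot f x q \<longlongrightarrow> G \<bullet> q) (at 0)" if "q \<in> S" for q
    proof -
      have "(dir_quot f x q \<longlongrightarrow> dir_deriv f x q) (at 0)"
        using elim that dir_derivI by blast
      moreover have "dir_deriv f x q = G \<bullet> q"
        using elim that by (simp add: G_def euclidean_representation inner_sum_right inner_commute[of _ q] mult.commute)
      ultimately show ?thesis by simp
    qed
    from lipschitz_differentiable_if_linear_on_dense[OF zero_less_one lipschitz_on_subset[OF lip subset_UNIV] dense this]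
    show ?case unfolding gderiv_def differentiable_def by blast
  qed
qed

lemma locally_lipschitz_on_compact:
  fixes f :: "'a::metric_space \<Rightarrow> 'b::metric_space"
  assumes "locally_lipschitz f" "compact K"
  obtains L where "L-lipschitz_on K f"
proof -
  have "local_lipschitz {0::real} K (\<lambda>_. f)"
    unfolding local_lipschitz_def
  proof (intro ballI)
    fix t :: real and x assume "x \<in> K"
    obtain r L where "r > 0" "L-lipschitz_on (cball x r) f"
      using assms(1) unfolding locally_lipschitz_def by blast
    then show "\<exists>u>0. \<exists>L. \<forall>t\<in>cball t u \<inter> {0}. L-lipschitz_on (cball x u \<inter> K) f"
      by (intro exI[of _ r]) (auto intro: lipschitz_on_subset)
  qed
  then show thesis
    using local_lipschitz_compact_implies_lipschitz[OF _ assms(2), of "{0::real}" "\<lambda>_. f"] that by auto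
qed

text \<open>
  The projection onto a ball is 1-Lipschitz and is the identity on the ball, so composing with it
  makes \<open>f\<close> globally Lipschitz and leaves it unchanged near interior points.
\<close>

theorem locally_lipschitz_differentiable_AE:
  fixes f :: "'a::euclidean_space \<Rightarrow> real"
  assumes loc: "locally_lipschitz f"
  shows "AE x in lborel. f differentiable (at x)"
proof -
  define P where "P = (\<lambda>n::nat. closest_point (cball (0::'a) (real n)))"
  have "AE x in lborel. (f \<circ> P n) differentiable (at x)" for n
  proof -
    obtain L where L: "L-lipschitz_on (cball 0 (real n)) f"
      using locally_lipschitz_on_compact[OF loc compact_cball] by blast
    have "1-lipschitz_on UNIV (P n)"
      unfolding P_def by (rule lipschitz_onI) (auto intro!: closest_point_lipschitz)
    moreover have "range (P n) \<subseteq> cball 0 (real n)"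
      unfolding P_def by (auto intro!: closest_point_in_set[of "cball 0 (real n)", unfolded mem_cball_0])
    ultimately have "(L * 1)-lipschitz_on UNIV (f \<circ> P n)"
      using L by (intro lipschitz_on_compose) (auto intro: lipschitz_on_subset)
    then show ?thesis by (rule lipschitz_differentiable_AE)
  qed
  then have "AE x in lborel. \<forall>n. (f \<circ> P n) differentiable (at x)"
    by (simp add: AE_all_countable)
  then show ?thesis
  proof eventually_elim
    case (elim x)
    obtain n where n: "norm x < real n"
      using reals_Archimedean2 by blast
    have "(f \<circ> P n) differentiable (at x)" using elim by blast
    then obtain D where "((f \<circ> P n) has_derivative D) (at x)"
      unfolding differentiable_def by blast
    then have "(f has_derivative D) (at x)"
      by (rule has_derivative_transform_within_open[OF _ open_ball[of 0 "real n"]])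
        (use n in \<open>auto simp: P_def closest_point_self\<close>)
    then show ?case unfolding differentiable_def by blast
  qed
qed

section \<open>Gradients\<close>

lemma differentiable_imp_GDERIV:
  fixes f :: "'a::euclidean_space \<Rightarrow> real"
  assumes "f differentiable (at x)"
  obtains G where "GDERIV f x :> G"
proof -
  obtain D where D: "(f has_derivative D) (at x)"
    using assms unfolding differentiable_def by blast
  interpret D: linear D using D by (rule has_derivative_linear)
  have "D v = v \<bullet> (\<Sum>b\<in>Basis. D b *\<^sub>R b)" for v
  proof -
    have "D v = D (\<Sum>b\<in>Basis. (v \<bullet> b) *\<^sub>R b)" by (simp add: euclidean_representation)
    also have "\<dots> = v \<bullet> (\<Sum>b\<in>Basis. D b *\<^sub>R b)"
      by (simp add: D.sum D.scale inner_sum_right mult.commute)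
    finally show ?thesis .
  qed
  then have "D = (\<lambda>v. v \<bullet> (\<Sum>b\<in>Basis. D b *\<^sub>R b))" ..
  with D that show thesis unfolding gderiv_def by metis
qed

lemma GDERIV_imp_grad:
  assumes "GDERIV f x :> G"
  shows "grad f x = G"
  unfolding grad_def
proof (rule the_equality)
  show "GDERIV f x :> G" by (rule assms)
next
  fix H assume "GDERIV f x :> H"
  then have "(\<lambda>h. h \<bullet> H) = (\<lambda>h. h \<bullet> G)"
    using assms unfolding gderiv_def by (rule has_derivative_unique)
  then have "(H - G) \<bullet> H = (H - G) \<bullet> G" by metis
  then have "(H - G) \<bullet> (H - G) = 0" by (simp add: inner_diff_right)
  then show "H = G" by simp
qed

lemma differentiable_GDERIV_grad:
  fixes f :: "'a::euclidean_space \<Rightarrow> real"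
  assumes "f differentiable (at x)"
  shows "GDERIV f x :> grad f x"
  using differentiable_imp_GDERIV[OF assms] GDERIV_imp_grad by metis

lemma GDERIV_dir_quot_tendsto:
  assumes "GDERIV f x :> G"
  shows "(dir_quot f x v \<longlongrightarrow> G \<bullet> v) (at 0)"
proof -
  have "((\<lambda>t. x + t *\<^sub>R v) has_derivative (\<lambda>t. t *\<^sub>R v)) (at 0)"
    by (auto intro!: derivative_eq_intros)
  then have "((\<lambda>t. f (x + t *\<^sub>R v)) has_derivative (\<lambda>t. (t *\<^sub>R v) \<bullet> G)) (at 0)"
    using has_derivative_compose[of "\<lambda>t. x + t *\<^sub>R v" "\<lambda>t. t *\<^sub>R v" 0 UNIV f "\<lambda>h. h \<bullet> G"] assms
    by (simp add: gderiv_def)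
  then have "DERIV (\<lambda>t. f (x + t *\<^sub>R v)) 0 :> G \<bullet> v"
    by (simp add: has_field_derivative_def inner_commute mult_commute_abs)
  then show ?thesis
    by (simp add: DERIV_def dir_quot_def[abs_def])
qed

lemma GDERIV_norm_le_lipschitz:
  assumes G: "GDERIV f x :> G" and "r > 0" and lip: "L-lipschitz_on (ball x r) f"
  shows "norm G \<le> L"
proof -
  have "((\<lambda>t. norm (t *\<^sub>R G)) \<longlongrightarrow> norm (0 *\<^sub>R G)) (at 0)"
    by (intro tendsto_intros)
  then have "\<forall>\<^sub>F t in at 0. norm (t *\<^sub>R G) < r"
    using \<open>r > 0\<close> by (intro order_tendstoD(2)[of _ "0"]) auto
  then have "\<forall>\<^sub>F t in at 0. dir_quot f x G t \<le> L * norm G"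
  proof eventually_elim
    case (elim t)
    then have "\<bar>dir_quot f x G t\<bar> \<le> L * norm G"
      using \<open>r > 0\<close> by (intro lipschitz_dir_quot_bound[OF lip]) (auto simp: dist_norm)
    then show ?case by simp
  qed
  then have "G \<bullet> G \<le> L * norm G"
    using tendsto_upperbound[OF GDERIV_dir_quot_tendsto[OF G]] by simp
  then have "norm G * norm G \<le> L * norm G"
    by (simp add: power2_norm_eq_inner[symmetric] power2_eq_square)
  then show ?thesis
    using lipschitz_on_nonneg[OF lip] by (cases "norm G = 0") auto
qed

lemma locally_lipschitz_continuous:
  assumes "locally_lipschitz f"
  shows "continuous_on UNIV f"
  unfolding continuous_on_eq_continuous_at[OF open_UNIV]
proof
  fix x
  obtain r L where "r > 0" "L-lipschitz_on (cball x r) f"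
    using assms unfolding locally_lipschitz_def by blast
  then have "continuous_on (cball x r) f" "x \<in> interior (cball x r)"
    by (auto intro: lipschitz_on_continuous_on simp: mem_interior_cball intro!: interiorI[of "ball x r"])
  then show "isCont f x" by (rule continuous_on_interior)
qed

text \<open>
  Measurability with respect to the Borel sets, not just their completion, is needed for the
  integrability of the gradient. For locally Lipschitz functions differentiability amounts to
  countably many Borel conditions, one for each direction in a dense set.
\<close>

lemma borel_pred_differentiable:
  fixes f :: "'a::euclidean_space \<Rightarrow> real"
  assumes loc: "locally_lipschitz f"
  shows "Measurable.pred borel (\<lambda>x. f differentiable (at x))"
proof -
  obtain S :: "'a set" where [simp]: "countable S"
    and dense: "\<And>X::'a set. open X \<Longrightarrow> X \<noteq> {} \<Longrightarrow> \<exists>q\<in>S. q \<in> X"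
    using countable_dense_setE by blast
  have cont: "continuous_on UNIV f"
    using loc by (rule locally_lipschitz_continuous)
  let ?lin = "\<lambda>q x. (\<exists>D. (dir_quot f x q \<longlongrightarrow> D) (at 0)) \<and>
      dir_deriv f x q = (\<Sum>b\<in>Basis. dir_deriv f x b *\<^sub>R b) \<bullet> q"
  have "f differentiable (at x) \<longleftrightarrow> (\<forall>q\<in>S. ?lin q x)" for x
  proof
    assume "f differentiable (at x)"
    then obtain G where G: "GDERIV f x :> G" using differentiable_imp_GDERIV by blast
    have dd: "dir_deriv f x v = G \<bullet> v" for v
      by (rule dir_derivI[OF GDERIV_dir_quot_tendsto[OF G]])
    show "\<forall>q\<in>S. ?lin q x"
      unfolding dd euclidean_representation using GDERIV_dir_quot_tendsto[OF G] by blast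
  next
    assume R: "\<forall>q\<in>S. ?lin q x"
    obtain r L where "r > 0" "L-lipschitz_on (cball x r) f"
      using loc unfolding locally_lipschitz_def by blast
    then have "L-lipschitz_on (ball x r) f" by (auto intro: lipschitz_on_subset)
    from lipschitz_differentiable_if_linear_on_dense[OF \<open>r > 0\<close> this dense,
        where G="\<Sum>b\<in>Basis. dir_deriv f x b *\<^sub>R b"]
    have "GDERIV f x :> (\<Sum>b\<in>Basis. dir_deriv f x b *\<^sub>R b)"
      using R dir_derivI by metis
    then show "f differentiable (at x)"
      unfolding gderiv_def differentiable_def by blast
  qed
  moreover note [measurable] = borel_pred_dir_limit[OF cont] borel_measurable_dir_deriv[OF cont]
  have "Measurable.pred borel (\<lambda>x. \<forall>q\<in>S. ?lin q x)"
    unfolding pred_def by (intro sets.sets_Collect_countable_All') measurable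
  ultimately show ?thesis by simp
qed

text \<open>
  At points of nondifferentiability the definite description ranges over an unsatisfiable
  predicate, so \<open>grad f\<close> takes one and the same value at all of them.
\<close>

lemma borel_measurable_grad:
  fixes f :: "'a::euclidean_space \<Rightarrow> real"
  assumes loc: "locally_lipschitz f"
  shows "grad f \<in> borel_measurable borel"
proof -
  note [measurable] = borel_pred_differentiable[OF loc]
    borel_measurable_dir_deriv[OF locally_lipschitz_continuous[OF loc]]
  have "grad f = (\<lambda>x. if f differentiable (at x) then (\<Sum>b\<in>Basis. dir_deriv f x b *\<^sub>R b) else (THE D. False))"
  proof
    fix x
    show "grad f x = (if f differentiable (at x) then (\<Sum>b\<in>Basis. dir_deriv f x b *\<^sub>R b) else (THE D. False))"
    proof (cases "f differentiable (at x)")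
      case True
      have "dir_deriv f x b = grad f x \<bullet> b" for b
        by (rule dir_derivI[OF GDERIV_dir_quot_tendsto[OF differentiable_GDERIV_grad[OF True]]])
      then show ?thesis using True by (simp add: euclidean_representation)
    next
      case False
      then have "\<not> GDERIV f x :> D" for D
        unfolding gderiv_def differentiable_def by blast
      then show ?thesis using False by (simp add: grad_def)
    qed
  qed
  then show ?thesis by (rule ssubst) measurable
qed

section \<open>Clarke subdifferentials\<close>

text \<open>
  The limsup also lets the base point vary, so it dominates the limit with base point fixed at \<open>x\<close>.
\<close>

lemma GDERIV_in_clarke_subdiff:
  assumes G: "GDERIV f x :> G"
  shows "G \<in> clarke_subdiff f x"
  unfolding clarke_subdiff_def
proof (intro CollectI allI)
  fix v
  show "ereal (G \<bullet> v) \<le> clarke_dderiv f x v"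
  proof (rule ccontr)
    assume "\<not> ?thesis"
    then obtain c where c: "clarke_dderiv f x v < ereal c" "c < G \<bullet> v"
      by (metis ereal_dense2 ereal_less_eq(3) less_ereal.simps(1) not_le)
    then have "\<forall>\<^sub>F (y, t) in nhds x \<times>\<^sub>F at_right 0. (f (y + t *\<^sub>R v) - f y) / t < c"
      unfolding clarke_dderiv_def using Limsup_lessD by (fastforce simp: case_prod_unfold)
    then obtain P Q where "eventually P (nhds x)" and Q: "eventually Q (at_right 0)"
      and PQ: "\<And>y t. P y \<Longrightarrow> Q t \<Longrightarrow> (f (y + t *\<^sub>R v) - f y) / t < c"
      unfolding eventually_prod_filter by auto
    then have "P x" by (simp add: eventually_nhds_x_imp_x)
    from Q have "\<forall>\<^sub>F t in at_right 0. dir_quot f x v t \<le> c"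
      by eventually_elim (use PQ[OF \<open>P x\<close>] in \<open>auto simp: dir_quot_def intro: less_imp_le\<close>)
    moreover have "(dir_quot f x v \<longlongrightarrow> G \<bullet> v) (at_right 0)"
      using GDERIV_dir_quot_tendsto[OF G] by (rule tendsto_mono[OF at_le[OF subset_UNIV]])
    ultimately have "G \<bullet> v \<le> c"
      by (intro tendsto_upperbound) auto
    with c show False by simp
  qed
qed

lemma clarke_dderiv_le_lipschitz:
  fixes f :: "'a::real_normed_vector \<Rightarrow> real"
  assumes "r > 0" and lip: "L-lipschitz_on (ball x r) f"
  shows "clarke_dderiv f x v \<le> ereal (L * norm v)"
  unfolding clarke_dderiv_def
proof (rule Limsup_bounded)
  have "((\<lambda>t. t * norm v) \<longlongrightarrow> 0 * norm v) (at_right 0)"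
    by (intro tendsto_intros)
  then have "\<forall>\<^sub>F t in at_right 0. t * norm v < r / 2"
    using \<open>r > 0\<close> by (intro order_tendstoD(2)[of _ "0"]) auto
  moreover have "\<forall>\<^sub>F t::real in at_right 0. 0 < t"
    by (simp add: eventually_at_right_less)
  ultimately have "\<forall>\<^sub>F t in at_right 0. 0 < t \<and> t * norm v < r / 2"
    by eventually_elim simp
  moreover have "\<forall>\<^sub>F y in nhds x. y \<in> ball x (r / 2)"
    using \<open>r > 0\<close> by (intro eventually_nhds_in_open) auto
  ultimately have "\<forall>\<^sub>F (y, t) in nhds x \<times>\<^sub>F at_right 0. y \<in> ball x (r / 2) \<and> 0 < t \<and> t * norm v < r / 2"
    by (auto simp: case_prod_unfold intro: eventually_prodI)
  then show "\<forall>\<^sub>F p in nhds x \<times>\<^sub>F at_right 0.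
      (case p of (y, t) \<Rightarrow> ereal ((f (y + t *\<^sub>R v) - f y) / t)) \<le> ereal (L * norm v)"
  proof (rule eventually_mono)
    fix p :: "'a \<times> real"
    obtain y t where p: "p = (y, t)" by fastforce
    assume "case p of (y, t) \<Rightarrow> y \<in> ball x (r / 2) \<and> 0 < t \<and> t * norm v < r / 2"
    then have y: "y \<in> ball x (r / 2)" and t: "0 < t" "t * norm v < r / 2"
      by (auto simp: p)
    have "dist x (y + t *\<^sub>R v) \<le> dist x y + norm (t *\<^sub>R v)"
      using norm_triangle_ineq4[of "x - y" "t *\<^sub>R v"] by (simp add: dist_norm algebra_simps)
    then have "y + t *\<^sub>R v \<in> ball x r" "y \<in> ball x r"
      using y t \<open>r > 0\<close> by auto
    from abs_le_D1[OF lipschitz_dir_quot_bound[OF lip this(2,1)]]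
    show "(case p of (y, t) \<Rightarrow> ereal ((f (y + t *\<^sub>R v) - f y) / t)) \<le> ereal (L * norm v)"
      by (simp add: dir_quot_def p)
  qed
qed

text \<open>
  Test the defining inequality of the subdifferential in the direction \<open>v = \<zeta>\<close>.
\<close>

lemma clarke_subdiff_norm_le_lipschitz:
  assumes "\<zeta> \<in> clarke_subdiff f x" "r > 0" "L-lipschitz_on (ball x r) f"
  shows "norm \<zeta> \<le> L"
proof -
  have "ereal (\<zeta> \<bullet> \<zeta>) \<le> ereal (L * norm \<zeta>)"
    using assms(1) clarke_dderiv_le_lipschitz[OF assms(2,3), of \<zeta>]
    unfolding clarke_subdiff_def by (blast intro: order_trans)
  then have "norm \<zeta> * norm \<zeta> \<le> L * norm \<zeta>"
    by (simp add: power2_norm_eq_inner[symmetric] power2_eq_square)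
  then show ?thesis
    using lipschitz_on_nonneg[OF assms(3)] by (cases "norm \<zeta> = 0") auto
qed

text \<open>
  A strict bound on the limsup at \<open>x\<close> is witnessed by a neighbourhood of \<open>x\<close>, which is also a
  neighbourhood of every point close to \<open>x\<close>.
\<close>

lemma clarke_dderiv_upper_semicontinuous:
  assumes "clarke_dderiv f x v < ereal c"
  shows "\<forall>\<^sub>F y in nhds x. clarke_dderiv f y v \<le> ereal c"
proof -
  have "\<forall>\<^sub>F (y, t) in nhds x \<times>\<^sub>F at_right 0. (f (y + t *\<^sub>R v) - f y) / t < c"
    using assms unfolding clarke_dderiv_def using Limsup_lessD by (fastforce simp: case_prod_unfold)
  then obtain P Q where P: "eventually P (nhds x)" and Q: "eventually Q (at_right 0)"
    and PQ: "\<And>y t. P y \<Longrightarrow> Q t \<Longrightarrow> (f (y + t *\<^sub>R v) - f y) / t < c"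
    unfolding eventually_prod_filter by auto
  from P have "\<forall>\<^sub>F y in nhds x. eventually P (nhds y)"
    by (simp add: eventually_eventually)
  then show ?thesis
  proof eventually_elim
    case (elim y)
    show ?case
      unfolding clarke_dderiv_def
    proof (rule Limsup_bounded, unfold eventually_prod_filter, intro exI[of _ P] exI[of _ Q] conjI allI impI)
      fix z t assume "P z" "Q t"
      then show "(case (z, t) of (z, t) \<Rightarrow> ereal ((f (z + t *\<^sub>R v) - f z) / t)) \<le> ereal c"
        using PQ by (simp add: less_imp_le)
    qed (use elim Q in auto)
  qed
qed

lemma clarke_subdiff_closed_graph:
  assumes y: "y \<longlonglongrightarrow> x" and \<zeta>: "\<zeta> \<longlonglongrightarrow> \<xi>" and "\<And>n. \<zeta> n \<in> clarke_subdiff f (y n)"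
  shows "\<xi> \<in> clarke_subdiff f x"
  unfolding clarke_subdiff_def
proof (intro CollectI allI)
  fix v
  show "ereal (\<xi> \<bullet> v) \<le> clarke_dderiv f x v"
  proof (rule ccontr)
    assume "\<not> ?thesis"
    then obtain c where c: "clarke_dderiv f x v < ereal c" "c < \<xi> \<bullet> v"
      by (metis ereal_dense2 ereal_less_eq(3) less_ereal.simps(1) not_le)
    have "\<forall>\<^sub>F n in sequentially. clarke_dderiv f (y n) v \<le> ereal c"
      using clarke_dderiv_upper_semicontinuous[OF c(1)] y by (rule eventually_compose_filterlim)
    then have "\<forall>\<^sub>F n in sequentially. \<zeta> n \<bullet> v \<le> c"
    proof eventually_elim
      case (elim n)
      have "ereal (\<zeta> n \<bullet> v) \<le> clarke_dderiv f (y n) v"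
        using assms(3)[of n] by (simp add: clarke_subdiff_def)
      also note elim
      finally show ?case by simp
    qed
    moreover have "(\<lambda>n. \<zeta> n \<bullet> v) \<longlonglongrightarrow> \<xi> \<bullet> v"
      by (intro tendsto_intros \<zeta>)
    ultimately have "\<xi> \<bullet> v \<le> c"
      by (intro tendsto_upperbound) auto
    with c show False by simp
  qed
qed

text \<open>
  Bounded by a Lipschitz constant on a slightly larger ball, and closed because the base points of a
  convergent sequence of subgradients accumulate in \<open>K\<close>.
\<close>

lemma compact_Union_clarke_subdiff:
  fixes f :: "'a::euclidean_space \<Rightarrow> real"
  assumes loc: "locally_lipschitz f" and K: "compact K"
  shows "compact (\<Union>y\<in>K. clarke_subdiff f y)"
  unfolding compact_eq_bounded_closed
proof
  obtain R where R: "\<And>y. y \<in> K \<Longrightarrow> norm y \<le> R"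
    using compact_imp_bounded[OF K] unfolding bounded_iff by blast
  obtain L where L: "L-lipschitz_on (cball 0 (R + 1)) f"
    using locally_lipschitz_on_compact[OF loc compact_cball] by blast
  have "norm \<zeta> \<le> L" if "y \<in> K" "\<zeta> \<in> clarke_subdiff f y" for y \<zeta>
  proof (rule clarke_subdiff_norm_le_lipschitz[OF that(2) zero_less_one])
    have "ball y 1 \<subseteq> cball 0 (R + 1)"
    proof
      fix z assume "z \<in> ball y 1"
      then show "z \<in> cball 0 (R + 1)"
        using R[OF that(1)] norm_triangle_ineq2[of z y] by (simp add: dist_norm norm_minus_commute)
    qed
    then show "L-lipschitz_on (ball y 1) f" using L by (rule lipschitz_on_subset[rotated])
  qed
  then show "bounded (\<Union>y\<in>K. clarke_subdiff f y)"
    unfolding bounded_iff by blast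
  show "closed (\<Union>y\<in>K. clarke_subdiff f y)"
    unfolding closed_sequential_limits
  proof (intro allI impI, elim conjE)
    fix \<zeta> \<xi> assume \<zeta>: "\<forall>n. \<zeta> n \<in> (\<Union>y\<in>K. clarke_subdiff f y)" "\<zeta> \<longlonglongrightarrow> \<xi>"
    then have "\<forall>n. \<exists>y. y \<in> K \<and> \<zeta> n \<in> clarke_subdiff f y" by blast
    from choice[OF this] obtain y where y: "\<And>n. y n \<in> K" "\<And>n. \<zeta> n \<in> clarke_subdiff f (y n)"
      by blast
    obtain x r where x: "x \<in> K" "strict_mono r" "(y \<circ> r) \<longlonglongrightarrow> x"
      using K y(1) unfolding compact_def by blast
    have "(\<zeta> \<circ> r) \<longlonglongrightarrow> \<xi>"
      using \<zeta>(2) x(2) by (rule LIMSEQ_subseq_LIMSEQ)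
    from clarke_subdiff_closed_graph[OF x(3) this, of f] y(2)
    have "\<xi> \<in> clarke_subdiff f x" by simp
    with x(1) show "\<xi> \<in> (\<Union>y\<in>K. clarke_subdiff f y)" by blast
  qed
qed

section \<open>Expectations over the unit ball\<close>

text \<open>
  A hyperplane strictly separating the mean from \<open>C\<close> would also separate it from almost all values
  of \<open>X\<close>.
\<close>

lemma (in prob_space) expectation_in_closed_convex:
  fixes X :: "'a \<Rightarrow> 'b::euclidean_space"
  assumes int: "integrable M X" and C: "convex C" "closed C" and "AE w in M. X w \<in> C"
  shows "(LINT w|M. X w) \<in> C"
proof (rule ccontr)
  assume "\<not> ?thesis"
  then obtain a b where ab: "a \<bullet> (LINT w|M. X w) < b" "\<And>y. y \<in> C \<Longrightarrow> b < a \<bullet> y"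
    using separating_hyperplane_closed_point[OF C] by metis
  have "b \<le> (LINT w|M. a \<bullet> X w)"
  proof (rule integral_ge_const)
    show "AE w in M. b \<le> a \<bullet> X w"
      using assms(4) by eventually_elim (use ab(2) in \<open>auto intro: less_imp_le\<close>)
  qed (use int in simp)
  also have "\<dots> = a \<bullet> (LINT w|M. X w)"
    using int by simp
  finally show False using ab(1) by simp
qed

lemma emeasure_unit_ball:
  "emeasure lborel (cball (0::'a::euclidean_space) 1) \<noteq> 0"
  "emeasure lborel (cball (0::'a::euclidean_space) 1) \<noteq> \<infinity>"
  by (simp_all add: emeasure_cball unit_ball_vol_def Gamma_real_pos less_imp_neq[symmetric] not_le)

lemma prob_space_unif_ball: "prob_space (unif_ball :: 'a::euclidean_space measure)"
  unfolding unif_ball_def using emeasure_unit_ball by (rule prob_space_uniform_measure)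

lemma sets_unif_ball [simp, measurable_cong]: "sets unif_ball = sets borel"
  by (simp add: unif_ball_def)

lemma AE_unif_ballI:
  fixes P :: "'a::euclidean_space \<Rightarrow> bool"
  assumes "AE w in lborel. w \<in> cball 0 1 \<longrightarrow> P w"
  shows "AE w in unif_ball. P w"
  unfolding unif_ball_def using assms by (intro AE_uniform_measureI) auto

lemma integral_unif_ball:
  fixes g :: "'a::euclidean_space \<Rightarrow> 'b::{banach, second_countable_topology}"
  assumes [measurable]: "g \<in> borel_measurable borel"
  shows "(LINT w|unif_ball. g w)
    = (1 / measure lborel (cball (0::'a) 1)) *\<^sub>R (LINT w|lborel. indicator (cball 0 1) w *\<^sub>R g w)"
proof -
  let ?V = "measure lborel (cball (0::'a) 1)"
  have V: "emeasure lborel (cball (0::'a) 1) = ennreal ?V"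
    using emeasure_unit_ball(2)[where 'a='a] by (simp add: emeasure_eq_ennreal_measure)
  then have "0 < ?V"
    using emeasure_unit_ball(1)[where 'a='a] by (cases "?V = 0") (auto simp: less_le)
  have dens: "unif_ball = density lborel (\<lambda>w::'a. ennreal (indicator (cball 0 1) w / ?V))"
    unfolding unif_ball_def uniform_measure_def V
    using \<open>0 < ?V\<close> by (intro density_cong) (auto simp: indicator_def divide_ennreal[symmetric])
  have "(LINT w|unif_ball. g w) = (LINT w|lborel. (indicator (cball 0 1) w / ?V) *\<^sub>R g w)"
    unfolding dens by (subst integral_density) (auto intro!: borel_measurable_divide borel_measurable_indicator)
  also have "\<dots> = (LINT w|lborel. (1 / ?V) *\<^sub>R (indicator (cball 0 1) w *\<^sub>R g w))"
    by simp
  also have "\<dots> = (1 / ?V) *\<^sub>R (LINT w|lborel. indicator (cball 0 1) w *\<^sub>R g w)"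
    by (rule integral_scaleR_right)
  finally show ?thesis .
qed

text \<open>
  Translation moves the parameter from the merely measurable \<open>g\<close> into the indicator of \<open>K\<close>, which is
  continuous in it off a null set.
\<close>

lemma continuous_on_integral_translate:
  fixes g :: "'a::euclidean_space \<Rightarrow> 'b::{banach, second_countable_topology}"
  assumes K: "convex K" "bounded K" "K \<in> sets borel"
    and g [measurable]: "g \<in> borel_measurable borel"
    and bound: "\<And>R. \<exists>B. AE y in lborel. norm y \<le> R \<longrightarrow> norm (g y) \<le> B"
  shows "continuous_on UNIV (\<lambda>c. LINT w|lborel. indicator K w *\<^sub>R g (c + w))"
proof -
  note [measurable] = K(3)
  let ?I = "\<lambda>c. LINT y|lborel. indicator K (y - c) *\<^sub>R g y"
  have shift: "(LINT w|lborel. indicator K w *\<^sub>R g (c + w)) = ?I c" for c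
    using integral_lborel_translate[of "\<lambda>y. indicator K (y - c) *\<^sub>R g y" c] by simp
  obtain R where R: "\<And>x. x \<in> K \<Longrightarrow> norm x \<le> R"
    using K(2) unfolding bounded_iff by blast
  have "isCont ?I c" for c
    unfolding continuous_within tendsto_at_iff_sequentially comp_def
      at_within_open[of c "ball c 1", simplified, symmetric]
  proof (intro allI impI)
    fix d assume d: "\<forall>n. d n \<in> ball c 1 - {c}" "d \<longlonglongrightarrow> c"
    obtain B where B: "AE y in lborel. norm y \<le> R + (norm c + 1) \<longrightarrow> norm (g y) \<le> B"
      using bound by blast
    show "(\<lambda>n. ?I (d n)) \<longlonglongrightarrow> ?I c"
    proof (rule integral_dominated_convergence[where w="\<lambda>y. B * indicator (cball 0 (R + (norm c + 1))) y"])
      show "integrable lborel (\<lambda>y::'a. B * indicator (cball 0 (R + (norm c + 1))) y)"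
        using emeasure_bounded_finite[of "cball (0::'a) (R + (norm c + 1))"]
        by (intro integrable_mult_right integrable_real_indicator) auto
      have "frontier K \<in> null_sets lborel"
        using negligible_convex_frontier[OF K(1)]
        by (simp add: negligible_iff_null_sets null_sets_completion_iff)
      then have "AE y in lborel. y \<notin> frontier K" by (rule AE_not_in)
      moreover have "Measurable.pred borel (\<lambda>y. y \<notin> frontier K)"
        using borel_closed[OF frontier_closed[of K]] by measurable
      ultimately have "AE y in lborel. - c + 1 *\<^sub>R y \<notin> frontier K"
        by (intro AE_lborel_affine) auto
      then show "AE y in lborel. (\<lambda>n. indicator K (y - d n) *\<^sub>R g y) \<longlonglongrightarrow> indicator K (y - c) *\<^sub>R g y"
      proof eventually_elim
        case (elim y)
        have "(\<lambda>n. y - d n) \<longlonglongrightarrow> y - c"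
          by (intro tendsto_intros d)
        then show ?case
          using elim by (intro tendsto_scaleR tendsto_const indicator_translate_tendsto) auto
      qed
      show "AE y in lborel. norm (indicator K (y - d n) *\<^sub>R g y)
          \<le> B * indicator (cball 0 (R + (norm c + 1))) y" for n
        using B
      proof eventually_elim
        case (elim y)
        have "norm (d n - c) < 1"
          using d(1) by (auto simp: dist_norm norm_minus_commute)
        then have "norm (d n) \<le> norm c + 1"
          using norm_triangle_ineq2[of "d n" c] by simp
        then have "norm y \<le> R + (norm c + 1)" if "y - d n \<in> K"
          using R[OF that] norm_triangle_ineq2[of y "d n"] by simp
        moreover have "0 \<le> B" if "norm y \<le> R + (norm c + 1)"
          using elim that norm_ge_zero order_trans by blast
        ultimately show ?case
          using elim by (auto simp: indicator_def)
      qed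
    qed measurable
  qed
  then show ?thesis
    by (simp add: shift continuous_at_imp_continuous_on)
qed

lemma integrable_unif_ball_bounded:
  fixes g :: "'a::euclidean_space \<Rightarrow> 'b::{banach, second_countable_topology}"
  assumes "g \<in> borel_measurable borel" "AE w in unif_ball. norm (g w) \<le> B"
  shows "integrable unif_ball g"
proof -
  interpret prob_space "unif_ball :: 'a measure" by (rule prob_space_unif_ball)
  show ?thesis using assms by (intro integrable_const_bound[of _ B]) auto
qed

text \<open>
  A single constant serves the unit balls around all points at distance at most \<open>R\<close> from \<open>x\<close>; it
  dominates increments and gradients simultaneously.
\<close>

lemma locally_lipschitz_uniform_on_unit_balls:
  fixes f :: "'a::euclidean_space \<Rightarrow> 'b::metric_space"
  assumes "locally_lipschitz f"
  obtains L where "\<And>y. dist x y \<le> R \<Longrightarrow> L-lipschitz_on (cball y 1) f"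
proof -
  obtain L where L: "L-lipschitz_on (cball x (R + 1)) f"
    using locally_lipschitz_on_compact[OF assms compact_cball] by blast
  have "L-lipschitz_on (cball y 1) f" if "dist x y \<le> R" for y
    using L by (rule lipschitz_on_subset) (use that in \<open>auto intro: order_trans[OF dist_triangle add_mono]\<close>)
  then show thesis using that by blast
qed

section \<open>The smoothed function\<close>

context
  fixes f :: "'a::euclidean_space \<Rightarrow> real" and \<delta> :: real
  assumes loc: "locally_lipschitz f" and pos: "\<delta> > 0"
begin

lemma borel_measurable_affine_grad: "(\<lambda>w. grad f (x + \<delta> *\<^sub>R w)) \<in> borel_measurable borel"
  using measurable_compose[OF _ borel_measurable_grad[OF loc], of "\<lambda>w. x + \<delta> *\<^sub>R w" borel] by simp

lemma AE_differentiable_affine: "AE w in lborel. f differentiable (at (x + \<delta> *\<^sub>R w))"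
  using pos
  by (intro AE_lborel_affine locally_lipschitz_differentiable_AE[OF loc] borel_pred_differentiable[OF loc]) simp

lemma AE_unif_ball_differentiable: "AE w in unif_ball. f differentiable (at (x + \<delta> *\<^sub>R w))"
  by (rule AE_unif_ballI) (use AE_differentiable_affine[of x] in eventually_elim, simp)

lemma AE_unif_ball_in_cball: "AE w in unif_ball. (x :: 'a) + \<delta> *\<^sub>R w \<in> cball x \<delta>"
proof (rule AE_unif_ballI, rule AE_I2, rule impI)
  fix w :: 'a assume "w \<in> cball 0 1"
  then show "x + \<delta> *\<^sub>R w \<in> cball x \<delta>"
    using pos mult_left_mono[of "norm w" 1 \<delta>] by (simp add: dist_norm)
qed

lemma grad_norm_le_lipschitz:
  assumes "f differentiable (at y)" "L-lipschitz_on (cball y 1) f"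
  shows "norm (grad f y) \<le> L"
  by (rule GDERIV_norm_le_lipschitz[OF differentiable_GDERIV_grad[OF assms(1)] zero_less_one
        lipschitz_on_subset[OF assms(2) ball_subset_cball]])

lemma integrable_smoothing: "integrable unif_ball (\<lambda>w. f (x + \<delta> *\<^sub>R w))"
proof -
  have cont: "continuous_on A f" for A
    using locally_lipschitz_continuous[OF loc] by (rule continuous_on_subset) simp
  obtain B where B: "\<And>y. y \<in> cball x \<delta> \<Longrightarrow> norm (f y) \<le> B"
    using compact_imp_bounded[OF compact_continuous_image[OF cont compact_cball[of x \<delta>]]]
    unfolding bounded_iff by (metis imageI)
  show ?thesis
  proof (rule integrable_unif_ball_bounded)
    show "(\<lambda>w. f (x + \<delta> *\<^sub>R w)) \<in> borel_measurable borel"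
      by (intro borel_measurable_continuous_onI continuous_on_compose2[OF cont[of UNIV]] continuous_intros) simp
    show "AE w in unif_ball. norm (f (x + \<delta> *\<^sub>R w)) \<le> B"
      using AE_unif_ball_in_cball[of x] by eventually_elim (rule B)
  qed
qed

lemma integrable_grad_smoothing: "integrable unif_ball (\<lambda>w. grad f (x + \<delta> *\<^sub>R w))"
proof -
  obtain L where L: "\<And>y. dist x y \<le> \<delta> \<Longrightarrow> L-lipschitz_on (cball y 1) f"
    using locally_lipschitz_uniform_on_unit_balls[OF loc] by blast
  show ?thesis
  proof (rule integrable_unif_ball_bounded[OF borel_measurable_affine_grad])
    show "AE w in unif_ball. norm (grad f (x + \<delta> *\<^sub>R w)) \<le> L"
      using AE_unif_ball_differentiable[of x] AE_unif_ball_in_cball[of x]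
      by eventually_elim (auto intro!: grad_norm_le_lipschitz L)
  qed
qed

text \<open>
  The first-order remainder divided by \<open>|h|\<close> tends to 0 at almost every \<open>w\<close> and is bounded by \<open>2 L\<close>
  for \<open>|h| < 1\<close>, where \<open>L\<close> is a Lipschitz constant near the ball of radius \<open>\<delta>\<close>. This yields the Frechet
  derivative at once, without passing through partial derivatives.
\<close>

lemma GDERIV_ball_smoothing:
  "GDERIV (ball_smoothing \<delta> f) x :> (LINT w|unif_ball. grad f (x + \<delta> *\<^sub>R w))" (is "GDERIV _ _ :> ?G")
proof -
  interpret prob_space "unif_ball :: 'a measure" by (rule prob_space_unif_ball)
  obtain L where L: "\<And>y. dist x y \<le> \<delta> \<Longrightarrow> L-lipschitz_on (cball y 1) f"
    using locally_lipschitz_uniform_on_unit_balls[OF loc] by blast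
  define q where "q = (\<lambda>h w. (f (x + \<delta> *\<^sub>R w + h) - f (x + \<delta> *\<^sub>R w) - h \<bullet> grad f (x + \<delta> *\<^sub>R w)) / norm h)"
  have int_h: "integrable unif_ball (\<lambda>w. f (x + \<delta> *\<^sub>R w + h))" for h
    using integrable_smoothing[of "x + h"] by (simp add: ac_simps)
  have int_q: "integrable unif_ball (q h)" for h
    unfolding q_def
    by (intro integrable_divide_zero Bochner_Integration.integrable_diff int_h integrable_smoothing
        integrable_inner_right integrable_grad_smoothing) 
  have q_eq: "(ball_smoothing \<delta> f (x + h) - ball_smoothing \<delta> f x - h \<bullet> ?G) / norm h = (LINT w|unif_ball. q h w)" for h
  proof -
    have "(\<lambda>w. f (x + h + \<delta> *\<^sub>R w)) = (\<lambda>w. f (x + \<delta> *\<^sub>R w + h))"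
      by (simp add: ac_simps)
    then show ?thesis
      using int_h[of h] integrable_smoothing[of x] integrable_grad_smoothing[of x]
      by (simp add: q_def ball_smoothing_def)
  qed
  have "((\<lambda>h. LINT w|unif_ball. q h w) \<longlongrightarrow> 0) (at 0)"
    unfolding tendsto_at_iff_sequentially comp_def
      at_within_open[of 0 "ball 0 1", simplified, symmetric]
  proof (intro allI impI)
    fix h :: "nat \<Rightarrow> 'a" assume h: "\<forall>n. h n \<in> ball 0 1 - {0}" "h \<longlonglongrightarrow> 0"
    then have h0: "filterlim h (at 0) sequentially"
      by (auto simp: filterlim_at)
    have "(\<lambda>n. LINT w|unif_ball. q (h n) w) \<longlonglongrightarrow> (LINT w|(unif_ball :: 'a measure). 0)"
    proof (rule integral_dominated_convergence[where w="\<lambda>_. 2 * L"])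
      show "AE w in unif_ball. (\<lambda>n. q (h n) w) \<longlonglongrightarrow> 0"
        using AE_unif_ball_differentiable[of x]
      proof eventually_elim
        case (elim w)
        let ?y = "x + \<delta> *\<^sub>R w"
        have "((\<lambda>k. norm (f (?y + k) - f ?y - k \<bullet> grad f ?y) / norm k) \<longlongrightarrow> 0) (at 0)"
          using differentiable_GDERIV_grad[OF elim] unfolding gderiv_def has_derivative_at by blast
        then have "((\<lambda>k. \<bar>q k w\<bar>) \<longlongrightarrow> 0) (at 0)"
          by (simp add: q_def)
        then have "((\<lambda>k. q k w) \<longlongrightarrow> 0) (at 0)"
          by (simp add: tendsto_rabs_zero_iff)
        then show ?case by (rule filterlim_compose[OF _ h0])
      qed
      show "AE w in unif_ball. norm (q (h n) w) \<le> 2 * L" for n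
        using AE_unif_ball_differentiable[of x] AE_unif_ball_in_cball[of x]
      proof eventually_elim
        case (elim w)
        let ?y = "x + \<delta> *\<^sub>R w"
        have n: "norm (h n) < 1" "norm (h n) > 0" using h(1) by auto
        have lip: "L-lipschitz_on (cball ?y 1) f" using elim L by simp
        have "\<bar>f (?y + h n) - f ?y\<bar> \<le> L * norm (h n)"
          using lipschitz_onD[OF lip, of "?y + h n" ?y] n by (simp add: dist_norm)
        moreover have "\<bar>h n \<bullet> grad f ?y\<bar> \<le> L * norm (h n)"
          unfolding mult.commute[of L]
          using grad_norm_le_lipschitz[OF elim(1) lip] n
          by (intro order_trans[OF Cauchy_Schwarz_ineq2] mult_left_mono) auto
        ultimately have "\<bar>f (?y + h n) - f ?y - h n \<bullet> grad f ?y\<bar> \<le> 2 * L * norm (h n)"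
          by linarith
        then show ?case
          using n by (simp add: q_def abs_divide pos_divide_le_eq)
      qed
    qed (use int_q in auto)
    then show "(\<lambda>n. LINT w|unif_ball. q (h n) w) \<longlonglongrightarrow> 0" by simp
  qed
  then have "((\<lambda>h. norm ((ball_smoothing \<delta> f (x + h) - ball_smoothing \<delta> f x - h \<bullet> ?G) / norm h)) \<longlongrightarrow> 0) (at 0)"
    unfolding q_eq by (rule tendsto_norm_zero)
  then show ?thesis
    unfolding gderiv_def has_derivative_at by (simp add: bounded_linear_inner_left)
qed

text \<open>
  Writing \<open>x + \<delta> w = \<delta> (x/\<delta> + w)\<close> reduces to translates of the rescaled gradient.
\<close>

lemma continuous_on_expected_grad:
  "continuous_on UNIV (\<lambda>x. LINT w|unif_ball. grad f (x + \<delta> *\<^sub>R w))"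
proof -
  let ?g = "\<lambda>y. grad f (0 + \<delta> *\<^sub>R y)"
  have "\<exists>B. AE y in lborel. norm y \<le> R \<longrightarrow> norm (?g y) \<le> B" for R
  proof -
    obtain L where L: "\<And>y. dist 0 y \<le> \<delta> * R \<Longrightarrow> L-lipschitz_on (cball y 1) f"
      using locally_lipschitz_uniform_on_unit_balls[OF loc] by blast
    have "AE y in lborel. norm y \<le> R \<longrightarrow> norm (?g y) \<le> L"
      using AE_differentiable_affine[of 0]
      by eventually_elim (use pos in \<open>auto intro!: grad_norm_le_lipschitz L mult_left_mono\<close>)
    then show ?thesis by blast
  qed
  then have "continuous_on UNIV (\<lambda>c. LINT w|lborel. indicator (cball (0::'a) 1) w *\<^sub>R ?g (c + w))"
    by (intro continuous_on_integral_translate borel_measurable_affine_grad) auto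
  then have "continuous_on UNIV (\<lambda>x. (1 / measure lborel (cball (0::'a) 1)) *\<^sub>R
      (LINT w|lborel. indicator (cball (0::'a) 1) w *\<^sub>R ?g ((1 / \<delta>) *\<^sub>R x + w)))"
    by (intro continuous_intros continuous_on_compose2[of UNIV _ UNIV "\<lambda>x. (1 / \<delta>) *\<^sub>R x"]) auto
  moreover have "?g ((1 / \<delta>) *\<^sub>R x + w) = grad f (x + \<delta> *\<^sub>R w)" for x w
    using pos by (simp add: scaleR_add_right)
  ultimately show ?thesis
    by (simp add: integral_unif_ball[OF borel_measurable_affine_grad])
qed

lemma expected_grad_in_goldstein_subdiff:
  "(LINT w|unif_ball. grad f (x + \<delta> *\<^sub>R w)) \<in> goldstein_subdiff \<delta> f x"
  unfolding goldstein_subdiff_def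
proof (rule prob_space.expectation_in_closed_convex[OF prob_space_unif_ball integrable_grad_smoothing])
  show "closed (convex hull (\<Union>y\<in>cball x \<delta>. clarke_subdiff f y))"
    by (intro compact_imp_closed compact_convex_hull compact_Union_clarke_subdiff[OF loc] compact_cball)
  show "AE w in unif_ball. grad f (x + \<delta> *\<^sub>R w) \<in> convex hull (\<Union>y\<in>cball x \<delta>. clarke_subdiff f y)"
    using AE_unif_ball_differentiable[of x] AE_unif_ball_in_cball[of x]
  proof eventually_elim
    case (elim w)
    then show ?case
      using GDERIV_in_clarke_subdiff[OF differentiable_GDERIV_grad[OF elim(1)]]
      by (intro hull_inc) blast
  qed
qed (rule convex_convex_hull)

end

theorem lemma2:
  fixes f :: "real ^ 'd \<Rightarrow> real"
    and \<alpha> :: "real ^ 'd \<Rightarrow> real"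
    and \<beta> :: "real ^ 'd \<Rightarrow> real \<Rightarrow> real"
    and \<delta> :: real
  assumes "locally_lipschitz f"
    and "subgradient_growth \<alpha> \<beta> f"
    and "\<delta> > 0"
  shows "(\<forall>x. integrable unif_ball (\<lambda>w. f (x + \<delta> *\<^sub>R w))) \<and>
    (\<forall>x. ball_smoothing \<delta> f differentiable (at x)) \<and>
    continuous_on UNIV (grad (ball_smoothing \<delta> f)) \<and>
    (\<forall>x. (AE w in unif_ball. f differentiable (at (x + \<delta> *\<^sub>R w))) \<and>
         integrable unif_ball (\<lambda>w. grad f (x + \<delta> *\<^sub>R w)) \<and>
         grad (ball_smoothing \<delta> f) x = (LINT w|unif_ball. grad f (x + \<delta> *\<^sub>R w))) \<and>
    (\<forall>x. grad (ball_smoothing \<delta> f) x \<in> goldstein_subdiff \<delta> f x)"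
proof -
  have G: "GDERIV (ball_smoothing \<delta> f) x :> (LINT w|unif_ball. grad f (x + \<delta> *\<^sub>R w))" for x
    by (rule GDERIV_ball_smoothing[OF assms(1,3)])
  then have grad: "grad (ball_smoothing \<delta> f) = (\<lambda>x. LINT w|unif_ball. grad f (x + \<delta> *\<^sub>R w))"
    by (intro ext GDERIV_imp_grad)
  have "ball_smoothing \<delta> f differentiable (at x)" for x
    using G unfolding gderiv_def differentiable_def by blast
  then show ?thesis
    unfolding grad
    using integrable_smoothing[OF assms(1,3)] continuous_on_expected_grad[OF assms(1,3)]
      AE_unif_ball_differentiable[OF assms(1,3)] integrable_grad_smoothing[OF assms(1,3)]
      expected_grad_in_goldstein_subdiff[OF assms(1,3)]
    by blast
qed

end
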